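(* Let $\mathbb{X}$ be a Polish space, $H_0$ a probability measure on $\mathbb{X}$ (not necessarily diffuse), $\mathfrak{q}$ and $\mathfrak{q}_0$ two EPPFs, and let $(p_0,p_1,\dots,p_I)$ be a vector of random probability measures such that $$p_i\mid p_0\ \overset{iid}{\sim}\ SSrp(\mathfrak{q},p_0),\quad i=1,\dots,I,\qquad p_0\sim SSrp(\mathfrak{q}_0,H_0).$$ Let $[\xi_{i,j}]_{i=1,\dots,I,\,j\ge1}$ be conditionally independent given $(p_1,\dots,p_I)$ with $\xi_{i,j}\mid(p_1,\dots,p_I)\sim p_i$ for $i=1,\dots,I$ and $j\ge1$. Then $[\xi_{i,j}]_{i=1,\dots,I,\,j\ge1}$ is a $HSSM(\mathfrak{q},\mathfrak{q}_0,H_0)$.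
   Context: Partitions. $\mathcal{P}_n$ is the set of partitions of $\{1,\dots,n\}$, written $\pi_n=[\pi_{1,n},\dots,\pi_{k,n}]$ with blocks in increasing order of least element; $|\pi_n|=k$ is the number of blocks. An exchangeable random partition of $\mathbb{N}$ is a sequence $(\Pi_n)_n$ of random partitions of $\{1,\dots,n\}$, consistent under restriction, each with permutation-invariant law; its EPPF is the symmetric function $\mathfrak{q}$ with $\mathbb{P}\{\Pi_n=\pi_n\}=\mathfrak{q}(|\pi_{1,n}|,\dots,|\pi_{k,n}|)=:\mathfrak{q}(\pi_n)$. Species sampling random probability. $p\sim SSrp(\mathfrak{q},H)$ (for any probability measure $H$ on $\mathbb{X}$, possibly with atoms) means that $p=\sum_{j\ge1}\tilde q_j\delta_{Z_j}$, where $(Z_j)_j$ are i.i.d. with law $H$, independent of the nonnegative random weights $(\tilde q_j)_j$ with $\sum_j\tilde q_j=1$ a.s., and $\mathfrak{q}(n_1,\dots,n_k)=\sum_{j_1,\dots,j_k}\mathbb{E}\big[\prod_{i=1}^k\tilde q_{j_i}^{\,n_i}\big]$, the sum ranging over ordered $k$-tuples of distinct positive integers. Hierarchical species sampling model. An array $[\xi_{i,j}]_{i=1,\dots,I,\,j\ge1}$ of $\mathbb{X}$-valued random variables is a $HSSM(\mathfrak{q},\mathfrak{q}_0,H_0)$ if for every vector of positive integers $(n_1,\dots,n_I)$ and all Borel sets $\{A_{i,j}: i=1,\dots,I,\ j=1,\dots,n_i\}$, $$\mathbb{P}\{\xi_{i,j}\in A_{i,j},\ i=1,\dots,I,\ j=1,\dots,n_i\}=\sum_{\pi^{(1)}_{n_1}\in\mathcal{P}_{n_1},\dots,\pi^{(I)}_{n_I}\in\mathcal{P}_{n_I}}\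 \prod_{i=1}^I\mathfrak{q}\big(\pi^{(i)}_{n_i}\big)\ \mathbb{E}\Big[\prod_{i=1}^I\prod_{c=1}^{|\pi^{(i)}_{n_i}|}\tilde p\Big(\bigcap_{j\in\pi^{(i)}_{c,n_i}}A_{i,j}\Big)\Big],$$ with $\tilde p\sim SSrp(\mathfrak{q}_0,H_0)$. *)

theory Defs
  imports "HOL-Probability.Probability" "HOL-Combinatorics.Permutations"
begin

definition partitions :: "nat \<Rightarrow> nat set set set" where
  "partitions n = {P. partition_on {1..n} P}"

definition blocks :: "nat set set \<Rightarrow> nat set list" where
  "blocks P = sorted_key_list_of_set Min P"

lemma (in linorder) sorted_key_list_of_set_inj_on:
  assumes "inj_on f S" "finite S"
  shows "set (sorted_key_list_of_set f S) = S"
    and "sorted (map f (sorted_key_list_of_set f S))"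
    and "distinct (sorted_key_list_of_set f S)"
proof -
  interpret fo: folding_insort_key "(\<le>)" "(<)" S f
    by unfold_locales (fact assms(1))
  show "set (sorted_key_list_of_set f S) = S"
    using fo.set_sorted_key_list_of_set assms(2) by simp
  show "sorted (map f (sorted_key_list_of_set f S))"
    using fo.sorted_sorted_key_list_of_set by simp
  show "distinct (sorted_key_list_of_set f S)"
    using fo.distinct_sorted_key_list_of_set distinct_map by blast
qed

lemma blocks_partition:
  assumes "P \<in> partitions n"
  shows "set (blocks P) = P" "sorted (map Min (blocks P))" "distinct (blocks P)"
proof -
  have P: "partition_on {1..n} P"
    using assms by (simp add: partitions_def)
  then have fin: "finite P"
    by (meson finite_atLeastAtMost finite_elements)
  have "inj_on Min P"
  proof (rule inj_onI)
    fix x y assume xy: "x \<in> P" "y \<in> P" "Min x = Min y"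
    have "finite x" "finite y" "x \<noteq> {}" "y \<noteq> {}"
      using P xy by (auto simp: partition_on_def dest: finite_subset[OF Union_upper, of _ P])
    then have "Min x \<in> x" "Min x \<in> y"
      using xy by (metis Min_in)+
    then show "x = y"
      using P xy by (auto simp: partition_on_def disjoint_def)
  qed
  then show "set (blocks P) = P" "sorted (map Min (blocks P))" "distinct (blocks P)"
    using fin by (simp_all add: blocks_def sorted_key_list_of_set_inj_on)
qed

definition block_sizes :: "nat set set \<Rightarrow> nat list" where
  "block_sizes P = map card (blocks P)"

definition exchangeable_random_partition ::
    "'w measure \<Rightarrow> (nat \<Rightarrow> 'w \<Rightarrow> nat set set) \<Rightarrow> bool" where
  "exchangeable_random_partition M R \<longleftrightarrow>
     prob_space M \<and>
     (\<forall>n\<ge>1. R n \<in> M \<rightarrow>\<^sub>M count_space (partitions n)) \<and>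
     (\<forall>n\<ge>1. \<forall>m\<ge>n. AE \<omega> in M. R n \<omega> = (\<lambda>B. B \<inter> {1..n}) ` R m \<omega> - {{}}) \<and>
     (\<forall>n\<ge>1. \<forall>\<sigma>. \<sigma> permutes {1..n} \<longrightarrow>
        distr M (count_space (partitions n)) (\<lambda>\<omega>. (`) \<sigma> ` R n \<omega>) =
        distr M (count_space (partitions n)) (R n))"

text \<open>
  The values of an EPPF on the empty list, and on lists with an entry \<open>0\<close>, have no meaning and
  are left unconstrained.
\<close>

definition EPPF_of ::
    "'w measure \<Rightarrow> (nat \<Rightarrow> 'w \<Rightarrow> nat set set) \<Rightarrow> (nat list \<Rightarrow> real) \<Rightarrow> bool" where
  "EPPF_of M R q \<longleftrightarrow>
     (\<forall>ns ms. 0 \<notin> set ns \<longrightarrow> mset ms = mset ns \<longrightarrow> q ms = q ns) \<and>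
     (\<forall>n\<ge>1. \<forall>P\<in>partitions n. measure M {\<omega> \<in> space M. R n \<omega> = P} = q (block_sizes P))"

text \<open>
  HOL does not allow quantification over the type of the sample space.  The sample space below is
  the path space, where every \<open>R\<close> can be realised: replace \<open>M\<close> by the law of
  the whole sequence.
\<close>

definition is_EPPF :: "(nat list \<Rightarrow> real) \<Rightarrow> bool" where
  "is_EPPF q \<longleftrightarrow>
     (\<exists>(M :: (nat \<Rightarrow> nat set set) measure) R. exchangeable_random_partition M R \<and> EPPF_of M R q)"

definition sigma_gen :: "'w measure \<Rightarrow> 'b measure \<Rightarrow> ('w \<Rightarrow> 'b) \<Rightarrow> 'w measure" where
  "sigma_gen M N X = vimage_algebra (space M) X N"

text \<open>
  Random probability measures are random elements of \<open>prob_algebra borel\<close>.  The sequences of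
  weights and atoms are indexed from \<open>0\<close>.  The sum in the last clause runs over the ordered
  tuples of distinct indices, represented as distinct lists.
\<close>

definition species_sampling_rp ::
    "'w measure \<Rightarrow> (nat list \<Rightarrow> real) \<Rightarrow> 'x::polish_space measure \<Rightarrow> ('w \<Rightarrow> 'x measure) \<Rightarrow> bool" where
  "species_sampling_rp M q H p \<longleftrightarrow>
     prob_space M \<and> p \<in> M \<rightarrow>\<^sub>M prob_algebra borel \<and> H \<in> space (prob_algebra borel) \<and>
     (\<exists>(w :: nat \<Rightarrow> 'w \<Rightarrow> real) (Z :: nat \<Rightarrow> 'w \<Rightarrow> 'x).
        prob_space.indep_vars M (\<lambda>_. borel) Z UNIV \<and>
        (\<forall>j. distr M borel (Z j) = H) \<and>
        (\<forall>j. w j \<in> borel_measurable M) \<and>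
        prob_space.indep_set M
          (sets (sigma_gen M (\<Pi>\<^sub>M j\<in>UNIV. borel) (\<lambda>\<omega> j. w j \<omega>)))
          (sets (sigma_gen M (\<Pi>\<^sub>M j\<in>UNIV. borel) (\<lambda>\<omega> j. Z j \<omega>))) \<and>
        (AE \<omega> in M. (\<forall>j. 0 \<le> w j \<omega>) \<and> (\<lambda>j. w j \<omega>) sums 1) \<and>
        (AE \<omega> in M. \<forall>A\<in>sets borel.
           (\<lambda>j. w j \<omega> * indicator A (Z j \<omega>)) sums measure (p \<omega>) A) \<and>
        (\<forall>ns. ns \<noteq> [] \<longrightarrow> 0 \<notin> set ns \<longrightarrow>
           ((\<lambda>js. \<integral>\<omega>. (\<Prod>i<length ns. w (js ! i) \<omega> ^ (ns ! i)) \<partial>M) has_sum q ns)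
             {js. length js = length ns \<and> distinct js}))"

text \<open>
  \<open>is_SSrp_law q H \<mu>\<close>: a random probability measure with law \<open>\<mu>\<close> is
  \<open>SSrp(q, H)\<close>.  As for \<open>is_EPPF\<close>, fixing the type of the sample space loses nothing:
  the representation only involves the joint law of the weights and the atoms, which also
  determine \<open>p\<close> almost surely.
\<close>

definition is_SSrp_law ::
    "(nat list \<Rightarrow> real) \<Rightarrow> 'x::polish_space measure \<Rightarrow> 'x measure measure \<Rightarrow> bool" where
  "is_SSrp_law q H \<mu> \<longleftrightarrow>
     (\<exists>(N :: ((nat \<Rightarrow> real) \<times> (nat \<Rightarrow> 'x)) measure) p.
        species_sampling_rp N q H p \<and> \<mu> = distr N (prob_algebra borel) p)"

definition cond_prob_alg :: "'w measure \<Rightarrow> 'w measure \<Rightarrow> 'w set \<Rightarrow> 'w \<Rightarrow> real" where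
  "cond_prob_alg M F A = real_cond_exp M F (indicator A)"

text \<open>\<open>\<kappa>\<close> is a regular version of the conditional law of \<open>X\<close> given \<open>F\<close>.\<close>

definition has_cond_law ::
    "'w measure \<Rightarrow> 'w measure \<Rightarrow> 'b measure \<Rightarrow> ('w \<Rightarrow> 'b) \<Rightarrow> ('w \<Rightarrow> 'b measure) \<Rightarrow> bool" where
  "has_cond_law M F N X \<kappa> \<longleftrightarrow>
     X \<in> M \<rightarrow>\<^sub>M N \<and> \<kappa> \<in> F \<rightarrow>\<^sub>M prob_algebra N \<and>
     (\<forall>A\<in>sets N. AE \<omega> in M.
        cond_prob_alg M F {\<omega>' \<in> space M. X \<omega>' \<in> A} \<omega> = measure (\<kappa> \<omega>) A)"

definition cond_indep_vars ::
    "'w measure \<Rightarrow> 'w measure \<Rightarrow> 'b measure \<Rightarrow> ('i \<Rightarrow> 'w \<Rightarrow> 'b) \<Rightarrow> 'i set \<Rightarrow> bool" where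
  "cond_indep_vars M F N X J \<longleftrightarrow>
     (\<forall>i\<in>J. X i \<in> M \<rightarrow>\<^sub>M N) \<and>
     (\<forall>S A. finite S \<longrightarrow> S \<subseteq> J \<longrightarrow> (\<forall>i\<in>S. A i \<in> sets N) \<longrightarrow>
        (AE \<omega> in M.
           cond_prob_alg M F {\<omega>' \<in> space M. \<forall>i\<in>S. X i \<omega>' \<in> A i} \<omega> =
           (\<Prod>i\<in>S. cond_prob_alg M F {\<omega>' \<in> space M. X i \<omega>' \<in> A i} \<omega>)))"

definition has_cond_SSrp_law ::
    "'w measure \<Rightarrow> (nat list \<Rightarrow> real) \<Rightarrow> ('w \<Rightarrow> 'x::polish_space measure) \<Rightarrow> ('w \<Rightarrow> 'x measure) \<Rightarrow> bool"
    where
  "has_cond_SSrp_law M q p0 p \<longleftrightarrow>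
     (\<exists>\<kappa>. has_cond_law M (sigma_gen M (prob_algebra borel) p0) (prob_algebra borel) p \<kappa> \<and>
          (AE \<omega> in M. is_SSrp_law q (p0 \<omega>) (\<kappa> \<omega>)))"

text \<open>
  The law \<open>SSrp(q0, H0)\<close> appears through its defining predicate: such a law is required to
  exist, and the formula is required of every such law.
\<close>

definition HSSM ::
    "'w measure \<Rightarrow> nat \<Rightarrow> (nat \<Rightarrow> nat \<Rightarrow> 'w \<Rightarrow> 'x::polish_space) \<Rightarrow>
     (nat list \<Rightarrow> real) \<Rightarrow> (nat list \<Rightarrow> real) \<Rightarrow> 'x measure \<Rightarrow> bool" where
  "HSSM M I \<xi> q q0 H0 \<longleftrightarrow>
     (\<forall>i\<in>{1..I}. \<forall>j\<ge>1. \<xi> i j \<in> M \<rightarrow>\<^sub>M borel) \<and>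
     (\<exists>\<mu>. is_SSrp_law q0 H0 \<mu>) \<and>
     (\<forall>\<mu>. is_SSrp_law q0 H0 \<mu> \<longrightarrow>
        (\<forall>(n :: nat \<Rightarrow> nat) (A :: nat \<Rightarrow> nat \<Rightarrow> 'x set).
           (\<forall>i\<in>{1..I}. 1 \<le> n i) \<longrightarrow>
           (\<forall>i\<in>{1..I}. \<forall>j\<in>{1..n i}. A i j \<in> sets borel) \<longrightarrow>
           measure M {\<omega> \<in> space M. \<forall>i\<in>{1..I}. \<forall>j\<in>{1..n i}. \<xi> i j \<omega> \<in> A i j} =
           (\<Sum>\<pi>\<in>(\<Pi>\<^sub>E i\<in>{1..I}. partitions (n i)).
              (\<Prod>i\<in>{1..I}. q (block_sizes (\<pi> i))) *
              (\<integral>m. (\<Prod>i\<in>{1..I}. \<Prod>c\<in>\<pi> i. measure m (\<Inter>j\<in>c. A i j)) \<partial>\<mu>))))"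

end

theory Submission
  imports Defs
begin

text \<open>
  The heart of the matter is the moment formula: if \<open>p\<close> is \<open>SSrp(q, H)\<close>, then
  \<open>E (p A\<^sub>1 \<cdots> p A\<^sub>n) = \<Sum>P. q P * (\<Prod>c\<in>P. H (\<Inter>i\<in>c. A\<^sub>i))\<close>,
  the sum being over the partitions \<open>P\<close> of \<open>{1..n}\<close>.  Expanding the product of the series
  \<open>p A = (\<Sum>j. w j * 1\<^sub>A (Z j))\<close> gives a sum over all maps \<open>f\<close> from \<open>{1..n}\<close> to the indices,
  which is grouped according to the kernel of \<open>f\<close>; the independence of weights and atoms then
  factorises each term.

  Conditioning on \<open>p\<^sub>1, \<dots>, p\<^sub>I\<close>, the probability in question is the expectation of
  \<open>\<Prod>i j. p\<^sub>i A\<^sub>i\<^sub>j\<close>.  Conditioning on \<open>p\<^sub>0\<close> and applying the moment formula to each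
  \<open>p\<^sub>i\<close> turns it into the required sum of expectations of products of values of \<open>p\<^sub>0\<close>.  By the
  moment formula for \<open>p\<^sub>0\<close>, these expectations only depend on \<open>q0\<close> and \<open>H0\<close>, so \<open>p\<^sub>0\<close> may be
  replaced by any other random probability measure that is \<open>SSrp(q0, H0)\<close>.
\<close>

section \<open>Maps on \<open>{1..n}\<close> grouped by their kernel partition\<close>

text \<open>This is the kernel of \<open>f\<close> on \<open>D\<close>. Indexing the level sets by
  points of \<open>D\<close> instead of values keeps the empty set out, so the result is a genuine
  partition for every \<open>f\<close>.\<close>

definition fibers :: "nat set \<Rightarrow> (nat \<Rightarrow> 'a) \<Rightarrow> nat set set" where
  "fibers D f = (\<lambda>i. {i'\<in>D. f i' = f i}) ` D"

lemma partition_on_fibers: "partition_on D (fibers D f)"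
  by (rule partition_onI) (auto simp: fibers_def disjnt_iff)

lemma finite_partitions: "finite (partitions n)"
  by (simp add: partitions_def finitely_many_partition_on)

lemma partitionsD:
  assumes "P \<in> partitions n"
  shows "finite P" "P \<noteq> {} \<longleftrightarrow> n \<ge> 1" "\<And>c. c \<in> P \<Longrightarrow> finite c" "\<And>c. c \<in> P \<Longrightarrow> c \<subseteq> {1..n}"
    "\<And>c. c \<in> P \<Longrightarrow> Min c \<in> c" "\<And>i. i \<in> {1..n} \<Longrightarrow> \<exists>c\<in>P. i \<in> c"
    "\<And>c d i. c \<in> P \<Longrightarrow> d \<in> P \<Longrightarrow> i \<in> c \<Longrightarrow> i \<in> d \<Longrightarrow> c = d"
proof -
  have P: "partition_on {1..n} P"
    using assms by (simp add: partitions_def)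
  show "finite P"
    using P finite_elements by blast
  show "P \<noteq> {} \<longleftrightarrow> n \<ge> 1"
    using P by (cases "n = 0") (auto simp: partition_on_def)
  show *: "c \<subseteq> {1..n}" if "c \<in> P" for c
    using P that by (auto simp: partition_on_def)
  show fin: "finite c" if "c \<in> P" for c
    using *[OF that] finite_subset by blast
  show "Min c \<in> c" if "c \<in> P" for c
    using P fin[OF that] that by (intro Min_in) (auto simp: partition_on_def)
  show "\<exists>c\<in>P. i \<in> c" if "i \<in> {1..n}" for i
    using P that by (auto simp: partition_on_def)
  show "c = d" if "c \<in> P" "d \<in> P" "i \<in> c" "i \<in> d" for c d i
    using P that by (auto simp: partition_on_def disjoint_def)
qed

text \<open>Constancy on the blocks says that \<open>P\<close> refines the kernel, injectivity on
  the representatives says that no two blocks merge. A map with kernel \<open>P\<close> is thus an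
  injective labelling of the blocks, read off at their least elements.\<close>

lemma fibers_eq_iff:
  assumes "P \<in> partitions n"
  shows "fibers {1..n} f = P \<longleftrightarrow>
    (\<forall>c\<in>P. \<forall>i\<in>c. f i = f (Min c)) \<and> inj_on (\<lambda>c. f (Min c)) P"
proof
  note PD = partitionsD[OF assms]
  assume f: "fibers {1..n} f = P"
  have blk: "c = {i'\<in>{1..n}. f i' = f i}" if c: "c \<in> P" "i \<in> c" for c i
  proof -
    obtain j where j: "c = {i'\<in>{1..n}. f i' = f j}"
      using c(1) unfolding f[symmetric] fibers_def by blast
    then have "f i = f j"
      using c(2) by simp
    then show ?thesis
      using j by simp
  qed
  show "(\<forall>c\<in>P. \<forall>i\<in>c. f i = f (Min c)) \<and> inj_on (\<lambda>c. f (Min c)) P"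
  proof
    show "\<forall>c\<in>P. \<forall>i\<in>c. f i = f (Min c)"
    proof (intro ballI)
      fix c i assume "c \<in> P" "i \<in> c"
      then show "f i = f (Min c)"
        using blk[of c "Min c"] PD(5) by blast
    qed
    show "inj_on (\<lambda>c. f (Min c)) P"
    proof (rule inj_onI)
      fix c d assume "c \<in> P" "d \<in> P" "f (Min c) = f (Min d)"
      then show "c = d"
        using blk[OF _ PD(5), of c] blk[OF _ PD(5), of d] by simp
    qed
  qed
next
  note PD = partitionsD[OF assms]
  assume f: "(\<forall>c\<in>P. \<forall>i\<in>c. f i = f (Min c)) \<and> inj_on (\<lambda>c. f (Min c)) P"
  have blk: "{i'\<in>{1..n}. f i' = f i} = c" if c: "c \<in> P" "i \<in> c" for c i
  proof (intro set_eqI iffI)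
    fix j assume j: "j \<in> {i'\<in>{1..n}. f i' = f i}"
    then obtain d where d: "d \<in> P" "j \<in> d"
      using PD(6) by blast
    have "f (Min d) = f j" "f i = f (Min c)"
      using f c d by auto
    then have "f (Min d) = f (Min c)"
      using j by simp
    then show "j \<in> c"
      using f c d by (auto dest: inj_onD)
  next
    fix j assume "j \<in> c"
    then show "j \<in> {i'\<in>{1..n}. f i' = f i}"
      using f c PD(4)[OF c(1)] by auto
  qed
  have "c \<in> fibers {1..n} f" if "c \<in> P" for c
    using blk[OF that PD(5)[OF that]] PD(4)[OF that] PD(5)[OF that] unfolding fibers_def by blast
  moreover have "c \<in> P" if "c \<in> fibers {1..n} f" for c
  proof -
    obtain i where "i \<in> {1..n}" "c = {i'\<in>{1..n}. f i' = f i}"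
      using \<open>c \<in> fibers {1..n} f\<close> unfolding fibers_def by blast
    then show ?thesis
      using blk PD(6)[of i] by auto
  qed
  ultimately show "fibers {1..n} f = P"
    by blast
qed

text \<open>
  A map on \<open>{1..n}\<close> with a prescribed kernel partition amounts to a tuple of distinct values,
  one for each block; this is how the sum over distinct tuples in the definition of a species
  sampling random probability arises.
\<close>

lemma bij_betw_distinct_tuples:
  assumes P: "P \<in> partitions n"
  shows "bij_betw (\<lambda>f. map (\<lambda>c. f (Min c)) (blocks P))
    {f \<in> {1..n} \<rightarrow>\<^sub>E S. fibers {1..n} f = P}
    {js. length js = length (blocks P) \<and> distinct js \<and> set js \<subseteq> S}"
    (is "bij_betw ?\<Phi> ?F ?J")
proof (rule bij_betw_imageI)
  note PD = partitionsD[OF P] and BP = blocks_partition[OF P]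
  show "inj_on ?\<Phi> ?F"
  proof (rule inj_onI)
    fix f g assume f: "f \<in> ?F" and g: "g \<in> ?F" and eq: "?\<Phi> f = ?\<Phi> g"
    have "f i = g i" if i: "i \<in> {1..n}" for i
    proof -
      obtain c where c: "c \<in> P" "i \<in> c"
        using PD(6)[OF i] by blast
      have "f i = f (Min c)" "g i = g (Min c)"
        using f g c fibers_eq_iff[OF P] by auto
      moreover have "f (Min c) = g (Min c)"
        using eq c BP(1) by auto
      ultimately show ?thesis
        by simp
    qed
    then show "f = g"
      using f g by (intro PiE_ext[of f "{1..n}" "\<lambda>_. S" g]) simp_all
  qed
  show "?\<Phi> ` ?F = ?J"
  proof (intro equalityI subsetI)
    fix js assume "js \<in> ?\<Phi> ` ?F"
    then obtain f where f: "f \<in> ?F" and js: "js = ?\<Phi> f"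
      by blast
    have "inj_on (\<lambda>c. f (Min c)) P"
      using f fibers_eq_iff[OF P] by auto
    moreover have "f (Min c) \<in> S" if "c \<in> P" for c
      using f PD(4,5)[OF that] by (auto simp: PiE_iff)
    ultimately show "js \<in> ?J"
      using BP by (auto simp: js distinct_map)
  next
    fix js assume js: "js \<in> ?J"
    \<comment> \<open>To recover a map from its tuple \<open>js\<close>, let \<open>k i\<close> be
      the position in \<open>blocks P\<close> of the block that contains \<open>i\<close>; the map
      then sends \<open>i\<close> to entry \<open>k i\<close> of \<open>js\<close>.\<close>
    have "\<forall>i\<in>{1..n}. \<exists>k<length (blocks P). i \<in> blocks P ! k"
      using PD(6) BP(1) by (metis in_set_conv_nth)
    then obtain k where k: "\<And>i. i \<in> {1..n} \<Longrightarrow> k i < length (blocks P)"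
      "\<And>i. i \<in> {1..n} \<Longrightarrow> i \<in> blocks P ! k i"
      by metis
    have kI: "k i = l" if "l < length (blocks P)" "i \<in> blocks P ! l" for i l
    proof -
      have l: "blocks P ! l \<in> P"
        using that BP(1) nth_mem by blast
      then have i: "i \<in> {1..n}"
        using that PD(4) by blast
      then have "blocks P ! k i = blocks P ! l"
      proof (intro PD(7)[OF _ l k(2)[OF i] that(2)])
        show "blocks P ! k i \<in> P"
          using nth_mem[OF k(1)[OF i]] BP(1) by simp
      qed
      then show ?thesis
        using BP(3) k(1)[OF i] that(1) nth_eq_iff_index_eq by blast
    qed
    define f where "f = (\<lambda>i\<in>{1..n}. js ! k i)"
    have fl: "f i = js ! l" if "l < length (blocks P)" "i \<in> blocks P ! l" for i l
    proof -
      have "blocks P ! l \<in> P"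
        using that BP(1) nth_mem by blast
      then have "i \<in> {1..n}"
        using that PD(4) by blast
      then show ?thesis
        using kI[OF that] by (simp add: f_def)
    qed
    have fMin: "f (Min (blocks P ! l)) = js ! l" if "l < length (blocks P)" for l
      using nth_mem[OF that] BP(1) by (intro fl[OF that] PD(5)) simp
    have "f \<in> {1..n} \<rightarrow>\<^sub>E S"
      using js k(1) nth_mem by (fastforce simp: f_def)
    moreover have "fibers {1..n} f = P"
      unfolding fibers_eq_iff[OF P]
    proof (intro conjI ballI)
      fix c i assume "c \<in> P" "i \<in> c"
      then show "f i = f (Min c)"
        using fl fMin BP(1) by (metis in_set_conv_nth)
    next
      show "inj_on (\<lambda>c. f (Min c)) P"
      proof (rule inj_onI)
        fix c d assume "c \<in> P" "d \<in> P" "f (Min c) = f (Min d)"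
        then obtain l m where "c = blocks P ! l" "d = blocks P ! m"
          "l < length (blocks P)" "m < length (blocks P)" "js ! l = js ! m"
          using fMin in_set_conv_nth[of _ "blocks P"] BP(1) by auto
        then show "c = d"
          using js by (simp add: nth_eq_iff_index_eq)
      qed
    qed
    moreover have "?\<Phi> f = js"
      using js fMin by (auto intro: nth_equalityI)
    ultimately show "js \<in> ?\<Phi> ` ?F"
      by blast
  qed
qed

text \<open>The summand depends on \<open>f\<close> only through its kernel and its block labels.
  Summing first over the maps with a fixed kernel and then encoding each of them by its labels gives
  sums over tuples without repetition.\<close>

lemma sum_PiE_by_fibers:
  fixes h :: "nat set set \<Rightarrow> 'a list \<Rightarrow> 'b :: comm_monoid_add"
  assumes "finite S"
  shows "(\<Sum>f\<in>{1..n} \<rightarrow>\<^sub>E S.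
      h (fibers {1..n} f) (map (\<lambda>c. f (Min c)) (blocks (fibers {1..n} f)))) =
    (\<Sum>P\<in>partitions n.
      \<Sum>js | length js = length (blocks P) \<and> distinct js \<and> set js \<subseteq> S. h P js)"
    (is "(\<Sum>f\<in>?E. ?h f) = _")
proof -
  have "(\<Sum>f\<in>?E. ?h f) = (\<Sum>P\<in>partitions n. \<Sum>f | f \<in> ?E \<and> fibers {1..n} f = P. ?h f)"
  proof (rule sum.group[symmetric])
    show "finite ?E"
      using assms by (simp add: finite_PiE)
    show "fibers {1..n} ` ?E \<subseteq> partitions n"
      using partition_on_fibers unfolding partitions_def by blast
  qed (rule finite_partitions)
  also have "\<dots> = (\<Sum>P\<in>partitions n.
      \<Sum>js | length js = length (blocks P) \<and> distinct js \<and> set js \<subseteq> S. h P js)"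
  proof (rule sum.cong[OF refl])
    fix P assume P: "P \<in> partitions n"
    have "(\<Sum>f | f \<in> ?E \<and> fibers {1..n} f = P. ?h f) =
        (\<Sum>f | f \<in> ?E \<and> fibers {1..n} f = P. h P (map (\<lambda>c. f (Min c)) (blocks P)))"
      by (rule sum.cong) simp_all
    also have "\<dots> = (\<Sum>js | length js = length (blocks P) \<and> distinct js \<and> set js \<subseteq> S. h P js)"
      by (rule sum.reindex_bij_betw[OF bij_betw_distinct_tuples[OF P]])
    finally show "(\<Sum>f | f \<in> ?E \<and> fibers {1..n} f = P. ?h f) =
      (\<Sum>js | length js = length (blocks P) \<and> distinct js \<and> set js \<subseteq> S. h P js)" .
  qed
  finally show ?thesis .
qed

lemma prod_blocks:
  assumes "P \<in> partitions n"
  shows "(\<Prod>c\<in>P. g c) = (\<Prod>l<length (blocks P). g (blocks P ! l))"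
  using blocks_partition[OF assms]
  by (intro prod.reindex_bij_betw[symmetric] bij_betw_nth) auto

text \<open>Serves two choices of \<open>g\<close>. If \<open>g\<close> is a weight that ignores its
  second argument, the inner product is a power whose exponent is the block size; if
  \<open>g\<close> is an indicator, the inner product is the indicator of an intersection.\<close>

lemma prod_fibers:
  assumes P: "P \<in> partitions n" and f: "fibers {1..n} f = P"
  shows "(\<Prod>i\<in>{1..n}. g (f i) i) = (\<Prod>c\<in>P. \<Prod>i\<in>c. g (f (Min c)) i)"
proof -
  have "(\<Prod>i\<in>{1..n}. g (f i) i) = (\<Prod>c\<in>P. \<Prod>i\<in>c. g (f i) i)"
    by (rule prod.partition) (use P in \<open>simp_all add: partitions_def\<close>)
  also have "\<dots> = (\<Prod>c\<in>P. \<Prod>i\<in>c. g (f (Min c)) i)"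
  proof (rule prod.cong[OF refl], rule prod.cong[OF refl])
    fix c i assume "c \<in> P" "i \<in> c"
    then have "f i = f (Min c)"
      using f[unfolded fibers_eq_iff[OF P]] by simp
    then show "g (f i) i = g (f (Min c)) i"
      by simp
  qed
  finally show ?thesis .
qed

section \<open>Factorisation by independence\<close>

text \<open>A function of \<open>X\<close> generates a smaller sigma-algebra than \<open>X\<close>
  does, and independence is inherited by smaller families. It is applied to the whole sequences of
  weights and of atoms, to separate expressions computed from finitely many of their
  entries.\<close>

lemma (in prob_space) indep_var_of_sigma_gen:
  assumes X: "random_variable S X" and Y: "random_variable T Y"
    and g: "g \<in> S \<rightarrow>\<^sub>M N1" and h: "h \<in> T \<rightarrow>\<^sub>M N2"
    and ind: "indep_set (sets (sigma_gen M S X)) (sets (sigma_gen M T Y))"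
  shows "indep_var N1 (\<lambda>\<omega>. g (X \<omega>)) N2 (\<lambda>\<omega>. h (Y \<omega>))"
proof -
  have sub: "sigma_sets (space M) {(\<lambda>\<omega>. k (U \<omega>)) -` A \<inter> space M |A. A \<in> sets N} \<subseteq> sets (sigma_gen M R U)"
    if "random_variable R U" "k \<in> R \<rightarrow>\<^sub>M N" for R :: "'e measure" and U k and N :: "'f measure"
  proof -
    have "U \<in> sigma_gen M R U \<rightarrow>\<^sub>M R"
      unfolding sigma_gen_def using measurable_space[OF that(1)]
      by (intro measurable_vimage_algebra1) auto
    then have "(\<lambda>\<omega>. k (U \<omega>)) \<in> sigma_gen M R U \<rightarrow>\<^sub>M N"
      using that(2) by (rule measurable_compose)
    moreover have "space (sigma_gen M R U) = space M"
      by (simp add: sigma_gen_def)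
    ultimately have "{(\<lambda>\<omega>. k (U \<omega>)) -` A \<inter> space M |A. A \<in> sets N} \<subseteq> sets (sigma_gen M R U)"
      by (auto dest: measurable_sets)
    then show ?thesis
      using sets.sigma_sets_subset[of _ "sigma_gen M R U"] by (simp add: sigma_gen_def)
  qed
  show ?thesis
    unfolding indep_var_eq indep_set_def
  proof (intro conjI)
    show "indep_sets (case_bool
        (sigma_sets (space M) {(\<lambda>\<omega>. g (X \<omega>)) -` A \<inter> space M |A. A \<in> sets N1})
        (sigma_sets (space M) {(\<lambda>\<omega>. h (Y \<omega>)) -` A \<inter> space M |A. A \<in> sets N2})) UNIV"
      by (rule indep_sets_mono_sets[OF ind[unfolded indep_set_def]])
        (use sub[OF X g] sub[OF Y h] in \<open>simp split: bool.split\<close>)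
  qed (use measurable_compose[OF X g] measurable_compose[OF Y h] in simp_all)
qed

text \<open>The product of indicators is the indicator of an intersection of events. As
  \<open>s\<close> is injective, each event concerns a different variable, so the probability
  factorises; all factors are computed with the common law \<open>H\<close>.\<close>

lemma (in prob_space) expectation_prod_indicator_indep:
  assumes Z: "indep_vars (\<lambda>_. N) Z UNIV" and H: "\<And>j. distr M N (Z j) = H"
    and K: "finite K" "K \<noteq> {}" "inj_on s K" and B: "\<And>k. k \<in> K \<Longrightarrow> B k \<in> sets N"
  shows "(\<integral>\<omega>. (\<Prod>k\<in>K. indicator (B k) (Z (s k) \<omega>)) \<partial>M) = (\<Prod>k\<in>K. measure H (B k))"
proof -
  have rv: "random_variable N (Z j)" for j
    using Z by (simp add: indep_vars_def)
  \<comment> \<open>Independence is stated for events indexed by the variables themselves, so the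
    sets are moved from \<open>K\<close> to its image under \<open>s\<close>.\<close>
  define B' where "B' j = B (the_inv_into K s j)" for j
  have B': "B' (s k) = B k" if "k \<in> K" for k
    using that K(3) by (simp add: B'_def the_inv_into_f_f)
  have "(\<integral>\<omega>. (\<Prod>k\<in>K. indicator (B k) (Z (s k) \<omega>)) \<partial>M)
      = (\<integral>\<omega>. (indicator (\<Inter>j\<in>s ` K. Z j -` B' j \<inter> space M) \<omega> :: real) \<partial>M)"
  proof (rule Bochner_Integration.integral_cong[OF refl])
    fix \<omega> assume \<omega>: "\<omega> \<in> space M"
    have "(\<Prod>k\<in>K. indicator (B k) (Z (s k) \<omega>)) =
        (if \<forall>k\<in>K. Z (s k) \<omega> \<in> B k then 1 else (0::real))"
      using K(1) by (auto simp: indicator_def intro!: prod.neutral)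
    also have "\<dots> = indicator (\<Inter>j\<in>s ` K. Z j -` B' j \<inter> space M) \<omega>"
      using \<omega> K(2) B' by (auto simp: indicator_def)
    finally show "(\<Prod>k\<in>K. indicator (B k) (Z (s k) \<omega>)) =
        (indicator (\<Inter>j\<in>s ` K. Z j -` B' j \<inter> space M) \<omega> :: real)" .
  qed
  also have "\<dots> = prob (\<Inter>j\<in>s ` K. Z j -` B' j \<inter> space M)"
  proof -
    have "(\<Inter>j\<in>s ` K. Z j -` B' j \<inter> space M) \<subseteq> space M"
      using K(2) by blast
    then show ?thesis
      by (simp add: Int_absorb2)
  qed
  also have "\<dots> = (\<Prod>j\<in>s ` K. prob (Z j -` B' j \<inter> space M))"
    using K B B' by (intro indep_varsD[OF Z]) auto
  also have "\<dots> = (\<Prod>k\<in>K. prob (Z (s k) -` B' (s k) \<inter> space M))"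
    by (rule prod.reindex[OF K(3), unfolded o_def])
  also have "\<dots> = (\<Prod>k\<in>K. measure H (B k))"
    using B' B rv H by (intro prod.cong refl) (metis measure_distr)
  finally show ?thesis .
qed

section \<open>The moment formula for species sampling random probabilities\<close>

text \<open>Finitely many tuples involve finitely many indices, all below some \<open>m0\<close>.
  Hence the tuples with entries below \<open>m\<close> exhaust the index set, and a
  \<open>has_sum\<close> over all tuples becomes an ordinary limit in \<open>m\<close>.\<close>

lemma filterlim_distinct_tuples:
  "filterlim (\<lambda>m. {js. length js = k \<and> distinct js \<and> set js \<subseteq> {..<m}})
    (finite_subsets_at_top {js. length js = k \<and> distinct (js :: nat list)}) sequentially"
  unfolding filterlim_finite_subsets_at_top
proof (intro allI impI)
  fix X assume X: "finite X \<and> X \<subseteq> {js. length js = k \<and> distinct (js :: nat list)}"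
  then have "finite (\<Union>js\<in>X. set js)"
    by simp
  then obtain m0 where m0: "(\<Union>js\<in>X. set js) \<subseteq> {..<m0}"
    using finite_nat_iff_bounded by blast
  show "\<forall>\<^sub>F m in sequentially. finite {js. length js = k \<and> distinct js \<and> set js \<subseteq> {..<m}} \<and>
      X \<subseteq> {js. length js = k \<and> distinct js \<and> set js \<subseteq> {..<m}} \<and>
      {js. length js = k \<and> distinct js \<and> set js \<subseteq> {..<m}} \<subseteq> {js. length js = k \<and> distinct js}"
    using eventually_ge_at_top[of m0]
  proof eventually_elim
    case (elim m)
    have "finite {js. set js \<subseteq> {..<m} \<and> length js = k}"
      by (intro finite_lists_length_eq) simp
    then have "finite {js. length js = k \<and> distinct js \<and> set js \<subseteq> {..<m}}"
      by (rule finite_subset[rotated]) blast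
    moreover have "set js \<subseteq> {..<m}" if "js \<in> X" for js
      using m0 elim that by fastforce
    ultimately show ?case
      using X by auto
  qed
qed

lemma AE_weights_le_1:
  assumes "AE \<omega> in N. (\<forall>j. 0 \<le> w j \<omega>) \<and> (\<lambda>j. w j \<omega>) sums (1::real)"
  shows "AE \<omega> in N. \<forall>j. 0 \<le> w j \<omega> \<and> w j \<omega> \<le> 1"
  using assms
proof eventually_elim
  case (elim \<omega>)
  have "w j \<omega> \<le> 1" for j
    using sum_le_suminf[of "\<lambda>j. w j \<omega>" "{j}"] elim by (auto simp: sums_iff)
  then show ?case
    using elim by simp
qed

text \<open>Moment formula for the first \<open>m\<close> atoms only. The expanded product is then a
  finite sum, so it can be rearranged and integrated term by term; the inner sums over tuples below
  \<open>m\<close> approximate the values of the EPPF.\<close>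

lemma expectation_truncated_product:
  fixes w :: "nat \<Rightarrow> 'w \<Rightarrow> real" and Z :: "nat \<Rightarrow> 'w \<Rightarrow> 'x::polish_space"
  assumes N: "prob_space N"
    and Z: "prob_space.indep_vars N (\<lambda>_. borel) Z UNIV" "\<And>j. distr N borel (Z j) = H"
    and w: "\<And>j. w j \<in> borel_measurable N"
    and ind: "prob_space.indep_set N
          (sets (sigma_gen N (\<Pi>\<^sub>M j\<in>UNIV. borel) (\<lambda>\<omega> j. w j \<omega>)))
          (sets (sigma_gen N (\<Pi>\<^sub>M j\<in>UNIV. borel) (\<lambda>\<omega> j. Z j \<omega>)))"
    and w1: "AE \<omega> in N. \<forall>j. 0 \<le> w j \<omega> \<and> w j \<omega> \<le> 1"
    and n: "1 \<le> n" and A: "\<And>i. i \<in> {1..n} \<Longrightarrow> A i \<in> sets borel"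
  shows "(\<integral>\<omega>. (\<Prod>i\<in>{1..n}. \<Sum>j<m. w j \<omega> * indicator (A i) (Z j \<omega>)) \<partial>N) =
    (\<Sum>P\<in>partitions n.
      (\<Sum>js | length js = length (blocks P) \<and> distinct js \<and> set js \<subseteq> {..<m}.
        \<integral>\<omega>. (\<Prod>l<length (blocks P). w (js ! l) \<omega> ^ (block_sizes P ! l)) \<partial>N) *
      (\<Prod>c\<in>P. measure H (\<Inter>i\<in>c. A i)))"
proof -
  interpret N: prob_space N by (fact N)
  note w[measurable]
  have Zm[measurable]: "Z j \<in> N \<rightarrow>\<^sub>M borel" for j
    using Z(1) by (simp add: N.indep_vars_def)
  \<comment> \<open>The term of the expanded product that belongs to the map \<open>f\<close> is
    \<open>a f * b f\<close>: \<open>a f\<close> collects the weights, \<open>b f\<close> the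
    atoms.\<close>
  define a where "a f \<omega> = (\<Prod>i\<in>{1..n}. w (f i) \<omega>)" for f \<omega>
  define b where "b f \<omega> = (\<Prod>i\<in>{1..n}. indicator (A i) (Z (f i) \<omega>) :: real)" for f \<omega>
  have a_int: "integrable N (a f)" for f
  proof (rule N.integrable_const_bound[where B=1])
    show "AE \<omega> in N. norm (a f \<omega>) \<le> 1"
      using w1 by eventually_elim (auto simp: a_def abs_prod intro!: prod_le_1)
  qed (simp add: a_def[abs_def])
  have b_meas: "b f \<in> borel_measurable N" for f
    unfolding b_def[abs_def] using A
    by (intro borel_measurable_prod measurable_compose[OF Zm borel_measurable_indicator]) auto
  have b_int: "integrable N (b f)" for f
  proof (rule N.integrable_const_bound[where B=1])
    show "AE \<omega> in N. norm (b f \<omega>) \<le> 1"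
      by (auto simp: b_def abs_prod intro!: prod_le_1)
  qed (rule b_meas)
  have ab: "N.indep_var borel (a f) borel (b f)" for f
  proof -
    \<comment> \<open>Both factors are displayed as functions applied to an entire sequence, the
      shape that \<open>indep_var_of_sigma_gen\<close> expects.\<close>
    have "N.indep_var borel (\<lambda>\<omega>. (\<lambda>x. \<Prod>i\<in>{1..n}. x (f i)) (\<lambda>j. w j \<omega>))
        borel (\<lambda>\<omega>. (\<lambda>x. \<Prod>i\<in>{1..n}. indicator (A i) (x (f i)) :: real) (\<lambda>j. Z j \<omega>))"
    proof (rule N.indep_var_of_sigma_gen[OF _ _ _ _ ind])
      show "(\<lambda>x. \<Prod>i\<in>{1..n}. x (f i)) \<in> borel_measurable (\<Pi>\<^sub>M j\<in>UNIV. (borel :: real measure))"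
        by measurable
      show "(\<lambda>x. \<Prod>i\<in>{1..n}. indicator (A i) (x (f i)) :: real) \<in>
          borel_measurable (\<Pi>\<^sub>M j\<in>UNIV. (borel :: 'x measure))"
        using A by (intro borel_measurable_prod
            measurable_compose[OF measurable_component_singleton borel_measurable_indicator]) auto
    qed (auto intro!: measurable_PiM_single')
    then show ?thesis
      by (simp add: a_def[abs_def] b_def[abs_def])
  qed
  \<comment> \<open>The expected contribution of any map with kernel \<open>P\<close> and block
    labels \<open>js\<close>; the atom factor does not involve \<open>js\<close>, since all atoms
    have law \<open>H\<close>.\<close>
  define h where "h P js =
    (\<integral>\<omega>. (\<Prod>l<length (blocks P). w (js ! l) \<omega> ^ (block_sizes P ! l)) \<partial>N) *
      (\<Prod>c\<in>P. measure H (\<Inter>i\<in>c. A i))" for P js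
  have ab_h: "(\<integral>\<omega>. a f \<omega> * b f \<omega> \<partial>N) =
      h (fibers {1..n} f) (map (\<lambda>c. f (Min c)) (blocks (fibers {1..n} f)))" for f
  proof -
    define P where "P = fibers {1..n} f"
    have P: "P \<in> partitions n"
      by (simp add: P_def partitions_def partition_on_fibers)
    note PD = partitionsD[OF P] and pf = prod_fibers[OF P P_def[symmetric]]
    \<comment> \<open>A block contributes the weight of its label once per element, which yields the
      exponents in \<open>block_sizes P\<close>.\<close>
    have "a f \<omega> = (\<Prod>l<length (blocks P).
        w (map (\<lambda>c. f (Min c)) (blocks P) ! l) \<omega> ^ (block_sizes P ! l))" for \<omega>
      unfolding a_def by (subst pf) (simp add: prod_blocks[OF P] block_sizes_def)
    moreover have "(\<integral>\<omega>. b f \<omega> \<partial>N) = (\<Prod>c\<in>P. measure H (\<Inter>i\<in>c. A i))"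
    proof -
      have "b f \<omega> = (\<Prod>c\<in>P. indicator (\<Inter>i\<in>c. A i) (Z (f (Min c)) \<omega>))" for \<omega>
        unfolding b_def
      proof (subst pf, rule prod.cong[OF refl])
        fix c assume "c \<in> P"
        then have "finite c"
          by (rule PD(3))
        then show "(\<Prod>i\<in>c. indicator (A i) (Z (f (Min c)) \<omega>)) =
            (indicator (\<Inter>i\<in>c. A i) (Z (f (Min c)) \<omega>) :: real)"
          by (auto simp: indicator_def intro!: prod.neutral)
      qed
      moreover have "(\<integral>\<omega>. (\<Prod>c\<in>P. indicator (\<Inter>i\<in>c. A i) (Z (f (Min c)) \<omega>)) \<partial>N) =
          (\<Prod>c\<in>P. measure H (\<Inter>i\<in>c. A i))"
      proof (rule N.expectation_prod_indicator_indep[OF Z])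
        show "inj_on (\<lambda>c. f (Min c)) P"
          using fibers_eq_iff[OF P, of f] P_def by simp
        show "(\<Inter>i\<in>c. A i) \<in> sets borel" if "c \<in> P" for c
          using PD(3,4,5)[OF that] A by (intro sets.finite_INT) auto
      qed (use PD n in auto)
      ultimately show ?thesis
        by simp
    qed
    ultimately show ?thesis
      unfolding P_def[symmetric] h_def
      using N.indep_var_lebesgue_integral[OF ab a_int b_int, of f] by simp
  qed
  have "(\<integral>\<omega>. (\<Prod>i\<in>{1..n}. \<Sum>j<m. w j \<omega> * indicator (A i) (Z j \<omega>)) \<partial>N) =
      (\<integral>\<omega>. (\<Sum>f\<in>{1..n} \<rightarrow>\<^sub>E {..<m}. a f \<omega> * b f \<omega>) \<partial>N)"
    by (subst prod_sum_PiE) (simp_all add: a_def b_def prod.distrib)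
  also have "\<dots> = (\<Sum>f\<in>{1..n} \<rightarrow>\<^sub>E {..<m}. \<integral>\<omega>. a f \<omega> * b f \<omega> \<partial>N)"
    using N.indep_var_integrable[OF ab a_int b_int] by (intro Bochner_Integration.integral_sum)
  also have "\<dots> = (\<Sum>P\<in>partitions n.
      \<Sum>js | length js = length (blocks P) \<and> distinct js \<and> set js \<subseteq> {..<m}. h P js)"
    unfolding ab_h by (rule sum_PiE_by_fibers) simp
  finally show ?thesis
    by (simp add: h_def sum_distrib_right)
qed

text \<open>Both sides are limits of the truncated expectations. The left side arises by dominated
  convergence. On the right, the sum over partitions is finite and each coefficient converges to
  \<open>q (block_sizes P)\<close> by the series for \<open>q\<close>.\<close>

proposition species_sampling_rp_moments:
  fixes H :: "'x::polish_space measure"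
  assumes p: "species_sampling_rp N q H p"
    and n: "1 \<le> n" and A: "\<And>i. i \<in> {1..n} \<Longrightarrow> A i \<in> sets borel"
  shows "(\<integral>\<omega>. (\<Prod>i\<in>{1..n}. measure (p \<omega>) (A i)) \<partial>N) =
    (\<Sum>P\<in>partitions n. q (block_sizes P) * (\<Prod>c\<in>P. measure H (\<Inter>i\<in>c. A i)))"
proof -
  obtain w :: "nat \<Rightarrow> _ \<Rightarrow> real" and Z :: "nat \<Rightarrow> _ \<Rightarrow> 'x" where
    Z: "prob_space.indep_vars N (\<lambda>_. borel) Z UNIV" "\<And>j. distr N borel (Z j) = H"
    and w[measurable]: "\<And>j. w j \<in> borel_measurable N"
    and ind: "prob_space.indep_set N
          (sets (sigma_gen N (\<Pi>\<^sub>M j\<in>UNIV. borel) (\<lambda>\<omega> j. w j \<omega>)))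
          (sets (sigma_gen N (\<Pi>\<^sub>M j\<in>UNIV. borel) (\<lambda>\<omega> j. Z j \<omega>)))"
    and w1: "AE \<omega> in N. (\<forall>j. 0 \<le> w j \<omega>) \<and> (\<lambda>j. w j \<omega>) sums 1"
    and wZ: "AE \<omega> in N. \<forall>A\<in>sets borel.
           (\<lambda>j. w j \<omega> * indicator A (Z j \<omega>)) sums measure (p \<omega>) A"
    and q: "\<And>ns. ns \<noteq> [] \<Longrightarrow> 0 \<notin> set ns \<Longrightarrow>
           ((\<lambda>js. \<integral>\<omega>. (\<Prod>i<length ns. w (js ! i) \<omega> ^ (ns ! i)) \<partial>N) has_sum q ns)
             {js. length js = length ns \<and> distinct js}"
    using p unfolding species_sampling_rp_def by auto
  have N: "prob_space N" and pm[measurable]: "p \<in> N \<rightarrow>\<^sub>M prob_algebra borel"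
    using p by (simp_all add: species_sampling_rp_def)
  interpret N: prob_space N by (fact N)
  have Zm[measurable]: "Z j \<in> N \<rightarrow>\<^sub>M borel" for j
    using Z(1) by (simp add: N.indep_vars_def)
  define S where "S m \<omega> = (\<Prod>i\<in>{1..n}. \<Sum>j<m. w j \<omega> * indicator (A i) (Z j \<omega>))" for m \<omega>
  have lim: "(\<lambda>m. integral\<^sup>L N (S m)) \<longlonglongrightarrow> (\<integral>\<omega>. (\<Prod>i\<in>{1..n}. measure (p \<omega>) (A i)) \<partial>N)"
  proof (rule integral_dominated_convergence[where w="\<lambda>_. 1"])
    show "(\<lambda>\<omega>. \<Prod>i\<in>{1..n}. measure (p \<omega>) (A i)) \<in> borel_measurable N"
      using A by (intro borel_measurable_prod measurable_compose[OF pm] measurable_measure_prob_algebra) auto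
    show "S m \<in> borel_measurable N" for m
      unfolding S_def[abs_def] using A
      by (intro borel_measurable_prod borel_measurable_sum borel_measurable_times w
          measurable_compose[OF Zm borel_measurable_indicator]) auto
    show "AE \<omega> in N. (\<lambda>m. S m \<omega>) \<longlonglongrightarrow> (\<Prod>i\<in>{1..n}. measure (p \<omega>) (A i))"
      using wZ
      by eventually_elim (use A in \<open>auto simp: S_def sums_def intro!: tendsto_prod\<close>)
    \<comment> \<open>Each factor is a partial sum of nonnegative terms dominated by the weights,
      whose total is 1.\<close>
    show "AE \<omega> in N. norm (S m \<omega>) \<le> 1" for m
      using w1
    proof eventually_elim
      case (elim \<omega>)
      have "(\<Sum>j<m. w j \<omega> * indicator (A i) (Z j \<omega>)) \<le> 1" for i
      proof -
        have "(\<Sum>j<m. w j \<omega> * indicator (A i) (Z j \<omega>)) \<le> (\<Sum>j<m. w j \<omega>)"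
          using elim by (intro sum_mono) (auto simp: indicator_def)
        also have "\<dots> \<le> 1"
          using elim sum_le_suminf[of "\<lambda>j. w j \<omega>" "{..<m}"] by (auto simp: sums_iff)
        finally show ?thesis .
      qed
      moreover have "0 \<le> (\<Sum>j<m. w j \<omega> * indicator (A i) (Z j \<omega>))" for i
        using elim by (intro sum_nonneg) auto
      ultimately show ?case
        by (auto simp: S_def abs_prod intro!: prod_le_1)
    qed
  qed simp
  have S_m: "integral\<^sup>L N (S m) =
    (\<Sum>P\<in>partitions n.
      (\<Sum>js | length js = length (blocks P) \<and> distinct js \<and> set js \<subseteq> {..<m}.
        \<integral>\<omega>. (\<Prod>l<length (blocks P). w (js ! l) \<omega> ^ (block_sizes P ! l)) \<partial>N) *
      (\<Prod>c\<in>P. measure H (\<Inter>i\<in>c. A i)))" for m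
    unfolding S_def[abs_def]
    by (rule expectation_truncated_product[OF N Z w ind AE_weights_le_1[OF w1] n A])
  have "(\<lambda>m. integral\<^sup>L N (S m)) \<longlonglongrightarrow>
      (\<Sum>P\<in>partitions n. q (block_sizes P) * (\<Prod>c\<in>P. measure H (\<Inter>i\<in>c. A i)))"
    unfolding S_m
  proof (intro tendsto_sum tendsto_mult_right)
    fix P assume P: "P \<in> partitions n"
    have len: "length (block_sizes P) = length (blocks P)"
      by (simp add: block_sizes_def)
    \<comment> \<open>The series for \<open>q\<close> is available for nonempty lists without zeros:
      \<open>1 \<le> n\<close> provides a block, and no block is empty.\<close>
    have "block_sizes P \<noteq> []"
      using blocks_partition(1)[OF P] partitionsD(2)[OF P] n by (auto simp: block_sizes_def)
    moreover have "0 \<notin> set (block_sizes P)"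
      using blocks_partition(1)[OF P] partitionsD(3,5)[OF P] by (fastforce simp: block_sizes_def)
    ultimately have "((\<lambda>js. \<integral>\<omega>. (\<Prod>l<length (blocks P). w (js ! l) \<omega> ^ (block_sizes P ! l)) \<partial>N)
        has_sum q (block_sizes P)) {js. length js = length (blocks P) \<and> distinct js}"
      using q len by fastforce
    then show "(\<lambda>m. \<Sum>js | length js = length (blocks P) \<and> distinct js \<and> set js \<subseteq> {..<m}.
        \<integral>\<omega>. (\<Prod>l<length (blocks P). w (js ! l) \<omega> ^ (block_sizes P ! l)) \<partial>N)
        \<longlonglongrightarrow> q (block_sizes P)"
      unfolding has_sum_def by (rule filterlim_compose[OF _ filterlim_distinct_tuples])
  qed
  with lim show ?thesis
    by (rule LIMSEQ_unique)
qed

section \<open>Moments of laws on the space of probability measures\<close>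

lemma borel_measurable_prod_measure:
  assumes "\<And>k. k \<in> K \<Longrightarrow> B k \<in> sets N"
  shows "(\<lambda>m. \<Prod>k\<in>K. measure m (B k)) \<in> borel_measurable (prob_algebra N)"
  using assms by (intro borel_measurable_prod measurable_measure_prob_algebra)

lemma prod_measure_bounds:
  assumes "m \<in> space (prob_algebra N)"
  shows "0 \<le> (\<Prod>k\<in>K. measure m (B k))" "(\<Prod>k\<in>K. measure m (B k)) \<le> 1"
  using assms by (auto simp: space_prob_algebra intro!: prod_nonneg prod_le_1 prob_space.prob_le_1)

text \<open>A change of variables moves the moment formula from a random probability measure to its
  law. This is the form that applies to a conditional law, at a fixed sample point.\<close>

lemma is_SSrp_law_moments:
  assumes \<mu>: "is_SSrp_law q H \<mu>"
    and n: "1 \<le> n" and A: "\<And>i. i \<in> {1..n} \<Longrightarrow> A i \<in> sets borel"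
  shows "(\<integral>m. (\<Prod>i\<in>{1..n}. measure m (A i)) \<partial>\<mu>) =
    (\<Sum>P\<in>partitions n. q (block_sizes P) * (\<Prod>c\<in>P. measure H (\<Inter>i\<in>c. A i)))"
proof -
  obtain N :: "((nat \<Rightarrow> real) \<times> (nat \<Rightarrow> 'a)) measure" and p where
    p: "species_sampling_rp N q H p" and \<mu>_eq: "\<mu> = distr N (prob_algebra borel) p"
    using \<mu> by (auto simp: is_SSrp_law_def)
  have "p \<in> N \<rightarrow>\<^sub>M prob_algebra borel"
    using p by (simp add: species_sampling_rp_def)
  then have "(\<integral>m. (\<Prod>i\<in>{1..n}. measure m (A i)) \<partial>\<mu>) =
      (\<integral>\<omega>. (\<Prod>i\<in>{1..n}. measure (p \<omega>) (A i)) \<partial>N)"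
    unfolding \<mu>_eq using A by (intro integral_distr borel_measurable_prod_measure) auto
  then show ?thesis
    by (simp only: species_sampling_rp_moments[OF p n A])
qed

text \<open>The right side of the moment formula involves only \<open>q\<close> and
  \<open>H\<close>. Enumerating \<open>K\<close> as \<open>{1..card K}\<close> makes this available
  for any finite nonempty family of sets, such as the blocks of several partitions at once.\<close>

lemma is_SSrp_law_moments_unique:
  assumes \<mu>: "is_SSrp_law q H \<mu>" and \<nu>: "is_SSrp_law q H \<nu>"
    and K: "finite K" "K \<noteq> {}" and B: "\<And>k. k \<in> K \<Longrightarrow> B k \<in> sets borel"
  shows "(\<integral>m. (\<Prod>k\<in>K. measure m (B k)) \<partial>\<mu>) = (\<integral>m. (\<Prod>k\<in>K. measure m (B k)) \<partial>\<nu>)"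
proof -
  obtain f where f: "bij_betw f {1..card K} K"
    using ex_bij_betw_nat_finite_1[OF K(1)] by blast
  have n: "1 \<le> card K"
    using K by (simp add: Suc_le_eq card_gt_0_iff)
  have B': "B (f i) \<in> sets borel" if "i \<in> {1..card K}" for i
    using bij_betw_apply[OF f that] by (rule B)
  have reindex: "(\<Prod>k\<in>K. measure m (B k)) = (\<Prod>i\<in>{1..card K}. measure m (B (f i)))"
    for m :: "'a measure"
    by (rule prod.reindex_bij_betw[OF f, symmetric])
  show ?thesis
    unfolding reindex using is_SSrp_law_moments[OF \<mu> n B'] is_SSrp_law_moments[OF \<nu> n B']
    by simp
qed

section \<open>Integration under conditional independence\<close>

lemma subalgebra_sigma_gen:
  assumes X: "X \<in> M \<rightarrow>\<^sub>M N"
  shows "subalgebra M (sigma_gen M N X)"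
proof -
  have "X \<in> space M \<rightarrow> space N"
    using measurable_space[OF X] by blast
  then have "sets (sigma_gen M N X) = {X -` A \<inter> space M | A. A \<in> sets N}"
    unfolding sigma_gen_def by (rule sets_vimage_algebra2)
  then show ?thesis
    using measurable_sets[OF X] by (auto simp: subalgebra_def sigma_gen_def)
qed

lemma (in prob_space) integral_cond_prob_alg:
  assumes "subalgebra M F" "A \<in> events"
  shows "(\<integral>\<omega>. cond_prob_alg M F A \<omega> \<partial>M) = prob A"
proof -
  interpret finite_measure_subalgebra M F
    by unfold_locales (fact assms(1))
  have "integrable M (indicator A :: 'a \<Rightarrow> real)"
    using assms(2) by (simp add: integrable_indicator_iff emeasure_eq_measure)
  then show ?thesis
    unfolding cond_prob_alg_def using assms(2) sets.sets_into_space
    by (simp add: real_cond_exp_int Int_absorb2)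
qed

text \<open>A probability is the mean of the conditional probability. The latter factorises almost
  surely by conditional independence, and each factor is a value of the regular conditional law
  \<open>\<kappa> i\<close>.\<close>

lemma (in prob_space) prob_cond_indep_vars:
  assumes F: "subalgebra M F" and X: "cond_indep_vars M F N X J" and S: "finite S" "S \<subseteq> J"
    and \<kappa>: "\<And>i. i \<in> S \<Longrightarrow> has_cond_law M F N (X i) (\<kappa> i)"
    and A: "\<And>i. i \<in> S \<Longrightarrow> A i \<in> sets N"
  shows "prob {\<omega>\<in>space M. \<forall>i\<in>S. X i \<omega> \<in> A i} = (\<integral>\<omega>. (\<Prod>i\<in>S. measure (\<kappa> i \<omega>) (A i)) \<partial>M)"
proof -
  let ?E = "{\<omega>\<in>space M. \<forall>i\<in>S. X i \<omega> \<in> A i}"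
  have X_meas: "X i \<in> M \<rightarrow>\<^sub>M N" and \<kappa>_meas: "\<kappa> i \<in> M \<rightarrow>\<^sub>M prob_algebra N" if "i \<in> S" for i
    using \<kappa>[OF that] measurable_from_subalg[OF F] by (auto simp: has_cond_law_def)
  have E: "?E \<in> events"
  proof -
    have "{\<omega>\<in>space M. X i \<omega> \<in> A i} \<in> events" if "i \<in> S" for i
      using measurable_sets[OF X_meas A, OF that that] by (simp add: vimage_def Int_def conj_commute)
    then show ?thesis
      using S(1) by (intro sets.sets_Collect_finite_All) auto
  qed
  have "AE \<omega> in M. cond_prob_alg M F ?E \<omega> =
      (\<Prod>i\<in>S. cond_prob_alg M F {\<omega>'\<in>space M. X i \<omega>' \<in> A i} \<omega>)"
    using X S A unfolding cond_indep_vars_def by blast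
  \<comment> \<open>Each \<open>i\<close> has its own null set; finiteness of \<open>S\<close>
    allows one null set for all of them.\<close>
  moreover have "AE \<omega> in M. \<forall>i\<in>S.
      cond_prob_alg M F {\<omega>'\<in>space M. X i \<omega>' \<in> A i} \<omega> = measure (\<kappa> i \<omega>) (A i)"
    using \<kappa> A S(1) by (intro AE_finite_allI) (auto simp: has_cond_law_def)
  ultimately have ae: "AE \<omega> in M. cond_prob_alg M F ?E \<omega> = (\<Prod>i\<in>S. measure (\<kappa> i \<omega>) (A i))"
    by eventually_elim simp
  have "prob ?E = (\<integral>\<omega>. cond_prob_alg M F ?E \<omega> \<partial>M)"
    by (rule integral_cond_prob_alg[OF F E, symmetric])
  also have "\<dots> = (\<integral>\<omega>. (\<Prod>i\<in>S. measure (\<kappa> i \<omega>) (A i)) \<partial>M)"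
  proof (rule integral_cong_AE[OF _ _ ae])
    show "cond_prob_alg M F ?E \<in> borel_measurable M"
      by (simp add: cond_prob_alg_def)
    show "(\<lambda>\<omega>. \<Prod>i\<in>S. measure (\<kappa> i \<omega>) (A i)) \<in> borel_measurable M"
      using \<kappa>_meas A
      by (intro borel_measurable_prod measurable_compose[OF _ measurable_measure_prob_algebra])
  qed
  finally show ?thesis .
qed

text \<open>
  The factors \<open>h i\<close> are turned from indicators into arbitrary functions one coordinate at a time:
  for a single coordinate, the two sides are integrals of \<open>h t\<close> against two measures, which agree
  on sets by the induction hypothesis.
\<close>

lemma (in prob_space) nn_integral_cond_indep_vars:
  fixes h :: "'i \<Rightarrow> 'b \<Rightarrow> ennreal"
  assumes F: "subalgebra M F" and X: "cond_indep_vars M F N X J" and S: "finite S" "S \<subseteq> J"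
    and \<kappa>: "\<And>i. i \<in> S \<Longrightarrow> has_cond_law M F N (X i) (\<kappa> i)"
    and h: "\<And>i. i \<in> S \<Longrightarrow> h i \<in> borel_measurable N"
  shows "(\<integral>\<^sup>+\<omega>. (\<Prod>i\<in>S. h i (X i \<omega>)) \<partial>M) = (\<integral>\<^sup>+\<omega>. (\<Prod>i\<in>S. \<integral>\<^sup>+x. h i x \<partial>\<kappa> i \<omega>) \<partial>M)"
proof -
  have X_meas: "X i \<in> M \<rightarrow>\<^sub>M N" and \<kappa>_meas: "\<kappa> i \<in> M \<rightarrow>\<^sub>M prob_algebra N" if "i \<in> S" for i
    using \<kappa>[OF that] measurable_from_subalg[OF F] by (auto simp: has_cond_law_def)
  note \<kappa>_sub = measurable_prob_algebraD[OF \<kappa>_meas]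
  have sets_\<kappa>: "sets (\<kappa> i \<omega>) = sets N" "prob_space (\<kappa> i \<omega>)" if "i \<in> S" "\<omega> \<in> space M" for i \<omega>
    using measurable_space[OF \<kappa>_meas[OF that(1)] that(2)] by (auto simp: space_prob_algebra)
  have hX: "(\<lambda>\<omega>. h i (X i \<omega>)) \<in> borel_measurable M"
    and h\<kappa>: "(\<lambda>\<omega>. \<integral>\<^sup>+x. h i x \<partial>\<kappa> i \<omega>) \<in> borel_measurable M"
    if "i \<in> S" "h i \<in> borel_measurable N" for i and h :: "'i \<Rightarrow> 'b \<Rightarrow> ennreal"
    using measurable_compose[OF X_meas[OF that(1)] that(2)]
      measurable_compose[OF \<kappa>_sub[OF that(1)] nn_integral_measurable_subprob_algebra[OF that(2)]]
    by auto
  have ind_prod: "(\<Prod>i\<in>S. indicator (A i) (x i) :: ennreal) = indicator {x. \<forall>i\<in>S. x i \<in> A i} x"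
    for A and x :: "'i \<Rightarrow> 'b"
    using S(1) by (auto simp: indicator_def intro!: prod.neutral)
  \<comment> \<open>\<open>T\<close> holds the coordinates with an arbitrary factor, while the
    others still carry indicators. The induction generalises over \<open>h\<close> because its
    hypothesis is applied to \<open>h(t := indicator A)\<close>.\<close>
  have "(\<integral>\<^sup>+\<omega>. (\<Prod>i\<in>S. h i (X i \<omega>)) \<partial>M) = (\<integral>\<^sup>+\<omega>. (\<Prod>i\<in>S. \<integral>\<^sup>+x. h i x \<partial>\<kappa> i \<omega>) \<partial>M)"
    if "T \<subseteq> S" "\<And>i. i \<in> S \<Longrightarrow> h i \<in> borel_measurable N"
      "\<And>i. i \<in> S - T \<Longrightarrow> \<exists>A\<in>sets N. h i = indicator A" for T and h :: "'i \<Rightarrow> 'b \<Rightarrow> ennreal"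
    using finite_subset[OF that(1) S(1)] that
  proof (induction T arbitrary: h rule: finite_induct)
    case empty
    then have "\<forall>i\<in>S. \<exists>A. A \<in> sets N \<and> h i = indicator A"
      by auto
    then obtain A where A: "\<And>i. i \<in> S \<Longrightarrow> A i \<in> sets N" "\<And>i. i \<in> S \<Longrightarrow> h i = indicator (A i)"
      by metis
    let ?E = "{\<omega>\<in>space M. \<forall>i\<in>S. X i \<omega> \<in> A i}"
    have "{\<omega>\<in>space M. X i \<omega> \<in> A i} \<in> events" if "i \<in> S" for i
      using measurable_sets[OF X_meas A(1), OF that that] by (simp add: vimage_def Int_def conj_commute)
    then have E: "?E \<in> events"
      using S(1) by (intro sets.sets_Collect_finite_All) auto
    have "(\<integral>\<^sup>+\<omega>. (\<Prod>i\<in>S. h i (X i \<omega>)) \<partial>M) = (\<integral>\<^sup>+\<omega>. indicator ?E \<omega> \<partial>M)"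
      using A(2) ind_prod[of A] by (intro nn_integral_cong) (simp add: indicator_def)
    also have "\<dots> = ennreal (prob ?E)"
      using E by (simp add: emeasure_eq_measure)
    also have "\<dots> = ennreal (\<integral>\<omega>. (\<Prod>i\<in>S. measure (\<kappa> i \<omega>) (A i)) \<partial>M)"
      by (simp only: prob_cond_indep_vars[OF F X S \<kappa> A(1)])
    also have "\<dots> = (\<integral>\<^sup>+\<omega>. ennreal (\<Prod>i\<in>S. measure (\<kappa> i \<omega>) (A i)) \<partial>M)"
    proof (rule nn_integral_eq_integral[symmetric])
      show "integrable M (\<lambda>\<omega>. \<Prod>i\<in>S. measure (\<kappa> i \<omega>) (A i))"
      proof (rule integrable_const_bound[where B=1])
        show "(\<lambda>\<omega>. \<Prod>i\<in>S. measure (\<kappa> i \<omega>) (A i)) \<in> borel_measurable M"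
          using \<kappa>_meas A(1)
          by (intro borel_measurable_prod measurable_compose[OF _ measurable_measure_prob_algebra])
        show "AE \<omega> in M. norm (\<Prod>i\<in>S. measure (\<kappa> i \<omega>) (A i)) \<le> 1"
          using sets_\<kappa>(2)
          by (intro AE_I2) (auto simp: abs_prod intro!: prod_le_1 prob_space.prob_le_1)
      qed
    qed (auto intro!: prod_nonneg)
    also have "\<dots> = (\<integral>\<^sup>+\<omega>. (\<Prod>i\<in>S. \<integral>\<^sup>+x. h i x \<partial>\<kappa> i \<omega>) \<partial>M)"
    proof (rule nn_integral_cong)
      fix \<omega> assume \<omega>: "\<omega> \<in> space M"
      have "ennreal (\<Prod>i\<in>S. measure (\<kappa> i \<omega>) (A i)) = (\<Prod>i\<in>S. ennreal (measure (\<kappa> i \<omega>) (A i)))"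
        by (simp add: prod_ennreal)
      also have "\<dots> = (\<Prod>i\<in>S. \<integral>\<^sup>+x. h i x \<partial>\<kappa> i \<omega>)"
      proof (rule prod.cong[OF refl])
        fix i assume i: "i \<in> S"
        interpret \<kappa>: prob_space "\<kappa> i \<omega>"
          by (rule sets_\<kappa>(2)[OF i \<omega>])
        show "ennreal (measure (\<kappa> i \<omega>) (A i)) = (\<integral>\<^sup>+x. h i x \<partial>\<kappa> i \<omega>)"
          using A[OF i] sets_\<kappa>(1)[OF i \<omega>] by (simp add: \<kappa>.emeasure_eq_measure)
      qed
      finally show "ennreal (\<Prod>i\<in>S. measure (\<kappa> i \<omega>) (A i)) = (\<Prod>i\<in>S. \<integral>\<^sup>+x. h i x \<partial>\<kappa> i \<omega>)" .
    qed
    finally show ?case .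
  next
    case (insert t T)
    then have t: "t \<in> S" and T: "T \<subseteq> S"
      by auto
    define R where "R \<omega> = (\<Prod>i\<in>S - {t}. h i (X i \<omega>))" for \<omega>
    define R' where "R' \<omega> = (\<Prod>i\<in>S - {t}. \<integral>\<^sup>+x. h i x \<partial>\<kappa> i \<omega>)" for \<omega>
    have R: "R \<in> borel_measurable M"
      unfolding R_def[abs_def] using insert.prems(2) hX by (intro borel_measurable_prod_ennreal) auto
    have R': "R' \<in> borel_measurable M"
      unfolding R'_def[abs_def] using insert.prems(2) h\<kappa> by (intro borel_measurable_prod_ennreal) auto
    \<comment> \<open>The factors other than \<open>t\<close> enter as densities \<open>R\<close>
      and \<open>R'\<close>. Integrating \<open>g\<close> against \<open>\<mu>\<close> and
      \<open>\<mu>'\<close> then gives the two sides of the claim with \<open>g\<close> in the place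
      of \<open>h t\<close>.\<close>
    define \<mu> where "\<mu> = distr (density M R) N (X t)"
    define \<mu>' where "\<mu>' = density M R' \<bind> \<kappa> t"
    have split_t: "(\<Prod>i\<in>S. (h(t := g)) i (X i \<omega>)) = R \<omega> * g (X t \<omega>)"
      "(\<Prod>i\<in>S. \<integral>\<^sup>+x. (h(t := g)) i x \<partial>\<kappa> i \<omega>) = R' \<omega> * (\<integral>\<^sup>+x. g x \<partial>\<kappa> t \<omega>)" for g \<omega>
      by (simp_all add: prod.remove[OF S(1) t] R_def R'_def mult.commute)
    have \<kappa>t: "\<kappa> t \<in> density M R' \<rightarrow>\<^sub>M subprob_algebra N"
      using \<kappa>_sub[OF t] by simp
    have \<mu>_int: "(\<integral>\<^sup>+x. g x \<partial>\<mu>) = (\<integral>\<^sup>+\<omega>. R \<omega> * g (X t \<omega>) \<partial>M)"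
      if "g \<in> borel_measurable N" for g
      using X_meas[OF t] R that measurable_compose[OF X_meas[OF t] that]
      by (simp add: \<mu>_def nn_integral_distr nn_integral_density)
    have \<mu>'_int: "(\<integral>\<^sup>+x. g x \<partial>\<mu>') = (\<integral>\<^sup>+\<omega>. R' \<omega> * (\<integral>\<^sup>+x. g x \<partial>\<kappa> t \<omega>) \<partial>M)"
      if "g \<in> borel_measurable N" for g
      unfolding \<mu>'_def nn_integral_bind[OF that \<kappa>t]
      by (intro nn_integral_density R'
          measurable_compose[OF \<kappa>_sub[OF t] nn_integral_measurable_subprob_algebra[OF that]])
    have sets_\<mu>: "sets \<mu> = sets N" "sets \<mu>' = sets N"
      using sets_bind[of "density M R'" "\<kappa> t" N] sets_\<kappa>(1)[OF t] not_empty
      by (simp_all add: \<mu>_def \<mu>'_def)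
    \<comment> \<open>Agreement is checked on every set of \<open>N\<close> and not just on a
      generator, so the argument covers densities with infinite integral.\<close>
    have "\<mu> = \<mu>'"
    proof (rule measure_eqI)
      show "sets \<mu> = sets \<mu>'"
        by (simp add: sets_\<mu>)
      fix A assume "A \<in> sets \<mu>"
      then have A: "A \<in> sets N"
        by (simp add: sets_\<mu>)
      have "(\<integral>\<^sup>+\<omega>. (\<Prod>i\<in>S. (h(t := indicator A)) i (X i \<omega>)) \<partial>M) =
          (\<integral>\<^sup>+\<omega>. (\<Prod>i\<in>S. \<integral>\<^sup>+x. (h(t := indicator A)) i x \<partial>\<kappa> i \<omega>) \<partial>M)"
      proof (rule insert.IH[OF T])
        show "(h(t := indicator A)) i \<in> borel_measurable N" if "i \<in> S" for i
          using insert.prems(2)[OF that] A by simp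
        show "\<exists>B\<in>sets N. (h(t := indicator A)) i = indicator B" if "i \<in> S - T" for i
          using insert.prems(3)[of i] that A by (cases "i = t") auto
      qed
      then have "(\<integral>\<^sup>+x. indicator A x \<partial>\<mu>) = (\<integral>\<^sup>+x. indicator A x \<partial>\<mu>')"
        unfolding split_t using A by (simp add: \<mu>_int \<mu>'_int)
      then show "emeasure \<mu> A = emeasure \<mu>' A"
        using A by (simp add: sets_\<mu>)
    qed
    moreover have "h t \<in> borel_measurable N"
      using insert.prems(2)[OF t] .
    moreover have "(\<Prod>i\<in>S. h i (X i \<omega>)) = R \<omega> * h t (X t \<omega>)"
      "(\<Prod>i\<in>S. \<integral>\<^sup>+x. h i x \<partial>\<kappa> i \<omega>) = R' \<omega> * (\<integral>\<^sup>+x. h t x \<partial>\<kappa> t \<omega>)" for \<omega>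
      by (simp_all add: prod.remove[OF S(1) t] R_def R'_def mult.commute)
    ultimately show ?case
      using \<mu>_int[of "h t"] \<mu>'_int[of "h t"] by simp
  qed
  from this[OF subset_refl] h show ?thesis
    by auto
qed

text \<open>Bounds between 0 and 1 make every integral finite, so the identity for nonnegative
  integrals passes to real ones. The intended \<open>h i\<close> sends a probability measure to a
  product of its values on given sets.\<close>

lemma (in prob_space) integral_cond_indep_vars:
  fixes h :: "'i \<Rightarrow> 'b \<Rightarrow> real"
  assumes F: "subalgebra M F" and X: "cond_indep_vars M F N X J" and S: "finite S" "S \<subseteq> J"
    and \<kappa>: "\<And>i. i \<in> S \<Longrightarrow> has_cond_law M F N (X i) (\<kappa> i)"
    and h: "\<And>i. i \<in> S \<Longrightarrow> h i \<in> borel_measurable N"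
    and h01: "\<And>i x. i \<in> S \<Longrightarrow> x \<in> space N \<Longrightarrow> 0 \<le> h i x \<and> h i x \<le> 1"
  shows "(\<integral>\<omega>. (\<Prod>i\<in>S. h i (X i \<omega>)) \<partial>M) = (\<integral>\<omega>. (\<Prod>i\<in>S. \<integral>x. h i x \<partial>\<kappa> i \<omega>) \<partial>M)"
proof -
  have X_meas: "X i \<in> M \<rightarrow>\<^sub>M N" and \<kappa>_meas: "\<kappa> i \<in> M \<rightarrow>\<^sub>M prob_algebra N" if "i \<in> S" for i
    using \<kappa>[OF that] measurable_from_subalg[OF F] by (auto simp: has_cond_law_def)
  note \<kappa>_sub = measurable_prob_algebraD[OF \<kappa>_meas]
  have sets_\<kappa>: "sets (\<kappa> i \<omega>) = sets N" "prob_space (\<kappa> i \<omega>)" if "i \<in> S" "\<omega> \<in> space M" for i \<omega>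
    using measurable_space[OF \<kappa>_meas[OF that(1)] that(2)] by (auto simp: space_prob_algebra)
  have \<kappa>_int: "0 \<le> (\<integral>x. h i x \<partial>\<kappa> i \<omega>)"
    "(\<integral>\<^sup>+x. ennreal (h i x) \<partial>\<kappa> i \<omega>) = ennreal (\<integral>x. h i x \<partial>\<kappa> i \<omega>)"
    if i: "i \<in> S" and \<omega>: "\<omega> \<in> space M" for i \<omega>
  proof -
    interpret \<kappa>: prob_space "\<kappa> i \<omega>"
      by (rule sets_\<kappa>(2)[OF i \<omega>])
    have sp: "space (\<kappa> i \<omega>) = space N"
      using sets_\<kappa>(1)[OF i \<omega>] by (rule sets_eq_imp_space_eq)
    have nonneg: "AE x in \<kappa> i \<omega>. 0 \<le> h i x"
      using h01[OF i] by (intro AE_I2) (simp add: sp)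
    then show "0 \<le> (\<integral>x. h i x \<partial>\<kappa> i \<omega>)"
      by (rule integral_nonneg_AE)
    have "integrable (\<kappa> i \<omega>) (h i)"
    proof (rule \<kappa>.integrable_const_bound[where B=1])
      show "AE x in \<kappa> i \<omega>. norm (h i x) \<le> 1"
        using h01[OF i] by (intro AE_I2) (simp add: sp)
      show "h i \<in> borel_measurable (\<kappa> i \<omega>)"
        using h[OF i] by (simp add: measurable_cong_sets[OF sets_\<kappa>(1)[OF i \<omega>] refl])
    qed
    then show "(\<integral>\<^sup>+x. ennreal (h i x) \<partial>\<kappa> i \<omega>) = ennreal (\<integral>x. h i x \<partial>\<kappa> i \<omega>)"
      using nonneg by (rule nn_integral_eq_integral)
  qed
  have hX: "0 \<le> h i (X i \<omega>)" if "i \<in> S" "\<omega> \<in> space M" for i \<omega>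
    using h01[OF that(1) measurable_space[OF X_meas[OF that(1)] that(2)]] by simp
  have "(\<integral>\<omega>. (\<Prod>i\<in>S. h i (X i \<omega>)) \<partial>M) = enn2real (\<integral>\<^sup>+\<omega>. ennreal (\<Prod>i\<in>S. h i (X i \<omega>)) \<partial>M)"
  proof (rule integral_eq_nn_integral)
    show "(\<lambda>\<omega>. \<Prod>i\<in>S. h i (X i \<omega>)) \<in> borel_measurable M"
      using measurable_compose[OF X_meas h] by (intro borel_measurable_prod) auto
    show "AE \<omega> in M. 0 \<le> (\<Prod>i\<in>S. h i (X i \<omega>))"
      using hX by (intro AE_I2 prod_nonneg) auto
  qed
  also have "(\<integral>\<^sup>+\<omega>. ennreal (\<Prod>i\<in>S. h i (X i \<omega>)) \<partial>M) = (\<integral>\<^sup>+\<omega>. (\<Prod>i\<in>S. ennreal (h i (X i \<omega>))) \<partial>M)"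
    using hX by (intro nn_integral_cong prod_ennreal[symmetric]) auto
  also have "\<dots> = (\<integral>\<^sup>+\<omega>. (\<Prod>i\<in>S. \<integral>\<^sup>+x. ennreal (h i x) \<partial>\<kappa> i \<omega>) \<partial>M)"
    using h by (intro nn_integral_cond_indep_vars[OF F X S \<kappa>]) auto
  also have "\<dots> = (\<integral>\<^sup>+\<omega>. ennreal (\<Prod>i\<in>S. \<integral>x. h i x \<partial>\<kappa> i \<omega>) \<partial>M)"
    using \<kappa>_int by (intro nn_integral_cong) (simp add: prod_ennreal)
  also have "enn2real \<dots> = (\<integral>\<omega>. (\<Prod>i\<in>S. \<integral>x. h i x \<partial>\<kappa> i \<omega>) \<partial>M)"
  proof (rule integral_eq_nn_integral[symmetric])
    show "(\<lambda>\<omega>. \<Prod>i\<in>S. \<integral>x. h i x \<partial>\<kappa> i \<omega>) \<in> borel_measurable M"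
      using h by (intro borel_measurable_prod
          measurable_compose[OF \<kappa>_sub integral_measurable_subprob_algebra]) auto
    show "AE \<omega> in M. 0 \<le> (\<Prod>i\<in>S. \<integral>x. h i x \<partial>\<kappa> i \<omega>)"
      using \<kappa>_int(1) by (intro AE_I2 prod_nonneg) auto
  qed
  finally show ?thesis .
qed

section \<open>The joint law of the hierarchical array\<close>

theorem proposition2:
  fixes M :: "'w measure"
    and I :: nat
    and H0 :: "'x::polish_space measure"
    and q q0 :: "nat list \<Rightarrow> real"
    and p0 :: "'w \<Rightarrow> 'x measure"
    and p :: "nat \<Rightarrow> 'w \<Rightarrow> 'x measure"
    and \<xi> :: "nat \<Rightarrow> nat \<Rightarrow> 'w \<Rightarrow> 'x"
  assumes "prob_space M"
    and "1 \<le> I"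
    and "H0 \<in> space (prob_algebra borel)"
    and "is_EPPF q"
    and "is_EPPF q0"
    and "p0 \<in> M \<rightarrow>\<^sub>M prob_algebra borel"
    and "\<And>i. i \<in> {1..I} \<Longrightarrow> p i \<in> M \<rightarrow>\<^sub>M prob_algebra borel"
    and "is_SSrp_law q0 H0 (distr M (prob_algebra borel) p0)"
    and "\<And>i. i \<in> {1..I} \<Longrightarrow> has_cond_SSrp_law M q p0 (p i)"
    and "cond_indep_vars M (sigma_gen M (prob_algebra borel) p0) (prob_algebra borel) p {1..I}"
    and "cond_indep_vars M
           (sigma_gen M (\<Pi>\<^sub>M i\<in>{1..I}. prob_algebra borel) (\<lambda>\<omega>. \<lambda>i\<in>{1..I}. p i \<omega>))
           borel (\<lambda>(i, j). \<xi> i j) ({1..I} \<times> {1..})"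
    and "\<And>i j. i \<in> {1..I} \<Longrightarrow> 1 \<le> j \<Longrightarrow>
           has_cond_law M
             (sigma_gen M (\<Pi>\<^sub>M i\<in>{1..I}. prob_algebra borel) (\<lambda>\<omega>. \<lambda>i\<in>{1..I}. p i \<omega>))
             borel (\<xi> i j) (p i)"
  shows "HSSM M I \<xi> q q0 H0"
proof -
  interpret M: prob_space M
    by (fact assms(1))
  let ?G = "sigma_gen M (\<Pi>\<^sub>M i\<in>{1..I}. prob_algebra borel) (\<lambda>\<omega>. \<lambda>i\<in>{1..I}. p i \<omega>)"
  let ?F = "sigma_gen M (prob_algebra borel) p0"
  let ?\<mu>0 = "distr M (prob_algebra borel) p0"
  note p0 = assms(6) and p = assms(7)
  have F: "subalgebra M ?F"
    using p0 by (rule subalgebra_sigma_gen)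
  have G: "subalgebra M ?G"
    using p by (intro subalgebra_sigma_gen measurable_restrict)
  have "\<forall>i\<in>{1..I}. \<exists>\<kappa>. has_cond_law M ?F (prob_algebra borel) (p i) \<kappa> \<and>
      (AE \<omega> in M. is_SSrp_law q (p0 \<omega>) (\<kappa> \<omega>))"
    using assms(9) by (auto simp: has_cond_SSrp_law_def)
  \<comment> \<open>For each \<open>i\<close>, \<open>\<kappa> i\<close> is a version of the
    conditional law of \<open>p i\<close> given \<open>p0\<close>, almost surely an SSrp law with
    base measure \<open>p0 \<omega>\<close>.\<close>
  then obtain \<kappa> where \<kappa>: "\<And>i. i \<in> {1..I} \<Longrightarrow> has_cond_law M ?F (prob_algebra borel) (p i) (\<kappa> i)"
    and \<kappa>_law: "\<And>i. i \<in> {1..I} \<Longrightarrow> AE \<omega> in M. is_SSrp_law q (p0 \<omega>) (\<kappa> i \<omega>)"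
    by metis
  have formula: "measure M {\<omega> \<in> space M. \<forall>i\<in>{1..I}. \<forall>j\<in>{1..n i}. \<xi> i j \<omega> \<in> A i j} =
      (\<Sum>\<pi>\<in>(\<Pi>\<^sub>E i\<in>{1..I}. partitions (n i)).
        (\<Prod>i\<in>{1..I}. q (block_sizes (\<pi> i))) *
        (\<integral>m. (\<Prod>i\<in>{1..I}. \<Prod>c\<in>\<pi> i. measure m (\<Inter>j\<in>c. A i j)) \<partial>\<mu>))"
    if \<mu>: "is_SSrp_law q0 H0 \<mu>" and n: "\<forall>i\<in>{1..I}. 1 \<le> n i"
      and A: "\<forall>i\<in>{1..I}. \<forall>j\<in>{1..n i}. A i j \<in> sets borel" for \<mu> n and A :: "nat \<Rightarrow> nat \<Rightarrow> 'x set"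
  proof -
    let ?S = "Sigma {1..I} (\<lambda>i. {1..n i})" and ?\<Pi> = "\<Pi>\<^sub>E i\<in>{1..I}. partitions (n i)"
    have inter: "(\<Inter>j\<in>c. A i j) \<in> sets borel"
      if "i \<in> {1..I}" "P \<in> partitions (n i)" "c \<in> P" for i P c
    proof (rule sets.finite_INT)
      show "A i j \<in> sets borel" if "j \<in> c" for j
        using A that partitionsD(4)[OF \<open>P \<in> _\<close> \<open>c \<in> P\<close>] \<open>i \<in> _\<close> by blast
      show "finite c" "c \<noteq> {}"
        using partitionsD(3,5)[OF that(2,3)] by auto
    qed
    have inter': "(\<Inter>j\<in>c. A i j) \<in> sets borel" if "\<pi> \<in> ?\<Pi>" "i \<in> {1..I}" "c \<in> \<pi> i" for \<pi> i c
      using that(2) PiE_mem[OF that(1,2)] that(3) by (rule inter)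
    \<comment> \<open>The conditional independence of the observations is assumed for a family
      indexed by pairs, so the event is rewritten over pairs.\<close>
    have "measure M {\<omega> \<in> space M. \<forall>i\<in>{1..I}. \<forall>j\<in>{1..n i}. \<xi> i j \<omega> \<in> A i j} =
        measure M {\<omega> \<in> space M. \<forall>ij\<in>?S. (\<lambda>(i, j). \<xi> i j) ij \<omega> \<in> (\<lambda>(i, j). A i j) ij}"
      by (intro arg_cong[where f = "measure M"]) auto
    \<comment> \<open>First conditioning, on the vector of all \<open>p i\<close>: here the
      conditional law of \<open>\<xi> i j\<close> is \<open>p i\<close> itself.\<close>
    also have "\<dots> = (\<integral>\<omega>. (\<Prod>ij\<in>?S. measure (p (fst ij) \<omega>) ((\<lambda>(i, j). A i j) ij)) \<partial>M)"
    proof (rule M.prob_cond_indep_vars[OF G assms(11)])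
      show "has_cond_law M ?G borel ((\<lambda>(i, j). \<xi> i j) ij) (p (fst ij))" if "ij \<in> ?S" for ij
        using assms(12)[of "fst ij" "snd ij"] that by (auto simp: case_prod_beta)
    qed (use A in auto)
    also have "\<dots> = (\<integral>\<omega>. (\<Prod>i\<in>{1..I}. \<Prod>j\<in>{1..n i}. measure (p i \<omega>) (A i j)) \<partial>M)"
      by (intro Bochner_Integration.integral_cong refl)
        (simp add: prod.Sigma case_prod_beta)
    \<comment> \<open>Second conditioning, on \<open>p0\<close>: the inner product over
      \<open>j\<close> is a function of \<open>p i\<close> alone, so it is averaged under
      \<open>\<kappa> i\<close>.\<close>
    also have "\<dots> = (\<integral>\<omega>. (\<Prod>i\<in>{1..I}. \<integral>m. (\<Prod>j\<in>{1..n i}. measure m (A i j)) \<partial>\<kappa> i \<omega>) \<partial>M)"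
    proof (rule M.integral_cond_indep_vars[OF F assms(10) _ _ \<kappa>])
      show "(\<lambda>m. \<Prod>j\<in>{1..n i}. measure m (A i j)) \<in> borel_measurable (prob_algebra borel)"
        if "i \<in> {1..I}" for i
        using A that by (intro borel_measurable_prod_measure) auto
    qed (use prod_measure_bounds in auto)
    also have "\<dots> = (\<integral>\<omega>. (\<Sum>\<pi>\<in>?\<Pi>. (\<Prod>i\<in>{1..I}. q (block_sizes (\<pi> i))) *
        (\<Prod>i\<in>{1..I}. \<Prod>c\<in>\<pi> i. measure (p0 \<omega>) (\<Inter>j\<in>c. A i j))) \<partial>M)"
    proof (rule integral_cong_AE)
      have \<kappa>_meas: "\<kappa> i \<in> M \<rightarrow>\<^sub>M prob_algebra (prob_algebra borel)" if "i \<in> {1..I}" for i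
        using \<kappa>[OF that] measurable_from_subalg[OF F] by (auto simp: has_cond_law_def)
      have "(\<lambda>m. \<Prod>j\<in>{1..n i}. measure m (A i j)) \<in> borel_measurable (prob_algebra borel)"
        if "i \<in> {1..I}" for i
        by (rule borel_measurable_prod_measure) (use A that in blast)
      then have "(\<lambda>\<omega>. \<integral>m. (\<Prod>j\<in>{1..n i}. measure m (A i j)) \<partial>\<kappa> i \<omega>) \<in> borel_measurable M"
        if "i \<in> {1..I}" for i
        using measurable_compose[OF measurable_prob_algebraD[OF \<kappa>_meas[OF that]]
            integral_measurable_subprob_algebra] that by blast
      then show "(\<lambda>\<omega>. \<Prod>i\<in>{1..I}. \<integral>m. (\<Prod>j\<in>{1..n i}. measure m (A i j)) \<partial>\<kappa> i \<omega>) \<in>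
          borel_measurable M"
        by (rule borel_measurable_prod)
      show "(\<lambda>\<omega>. \<Sum>\<pi>\<in>?\<Pi>. (\<Prod>i\<in>{1..I}. q (block_sizes (\<pi> i))) *
          (\<Prod>i\<in>{1..I}. \<Prod>c\<in>\<pi> i. measure (p0 \<omega>) (\<Inter>j\<in>c. A i j))) \<in> borel_measurable M"
        by (intro borel_measurable_sum borel_measurable_times borel_measurable_const
            borel_measurable_prod measurable_compose[OF p0 measurable_measure_prob_algebra])
          (rule inter')
      have "AE \<omega> in M. \<forall>i\<in>{1..I}. is_SSrp_law q (p0 \<omega>) (\<kappa> i \<omega>)"
        using \<kappa>_law by (intro AE_finite_allI) auto
      then show "AE \<omega> in M. (\<Prod>i\<in>{1..I}. \<integral>m. (\<Prod>j\<in>{1..n i}. measure m (A i j)) \<partial>\<kappa> i \<omega>) =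
          (\<Sum>\<pi>\<in>?\<Pi>. (\<Prod>i\<in>{1..I}. q (block_sizes (\<pi> i))) *
            (\<Prod>i\<in>{1..I}. \<Prod>c\<in>\<pi> i. measure (p0 \<omega>) (\<Inter>j\<in>c. A i j)))"
      proof eventually_elim
        case (elim \<omega>)
        have "(\<Prod>i\<in>{1..I}. \<integral>m. (\<Prod>j\<in>{1..n i}. measure m (A i j)) \<partial>\<kappa> i \<omega>) =
            (\<Prod>i\<in>{1..I}. \<Sum>P\<in>partitions (n i).
              q (block_sizes P) * (\<Prod>c\<in>P. measure (p0 \<omega>) (\<Inter>j\<in>c. A i j)))"
          using elim n A by (intro prod.cong refl is_SSrp_law_moments) auto
        \<comment> \<open>Expanding the product over \<open>i\<close> amounts to choosing one
          partition per row, which is the family \<open>\<pi>\<close>.\<close>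
        also have "\<dots> = (\<Sum>\<pi>\<in>?\<Pi>. \<Prod>i\<in>{1..I}.
              q (block_sizes (\<pi> i)) * (\<Prod>c\<in>\<pi> i. measure (p0 \<omega>) (\<Inter>j\<in>c. A i j)))"
          by (rule prod_sum_PiE) (simp_all add: finite_partitions)
        finally show ?case
          by (simp only: prod.distrib)
      qed
    qed
    also have "\<dots> = (\<Sum>\<pi>\<in>?\<Pi>. (\<Prod>i\<in>{1..I}. q (block_sizes (\<pi> i))) *
        (\<integral>m. (\<Prod>i\<in>{1..I}. \<Prod>c\<in>\<pi> i. measure m (\<Inter>j\<in>c. A i j)) \<partial>\<mu>))"
    proof -
      \<comment> \<open>Integrability is needed to exchange the integral with the sum over
        \<open>\<pi>\<close>; the equation replaces the law of \<open>p0\<close> by the given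
        \<open>\<mu>\<close>.\<close>
      have *: "integrable M (\<lambda>\<omega>. \<Prod>i\<in>{1..I}. \<Prod>c\<in>\<pi> i. measure (p0 \<omega>) (\<Inter>j\<in>c. A i j)) \<and>
          (\<integral>\<omega>. (\<Prod>i\<in>{1..I}. \<Prod>c\<in>\<pi> i. measure (p0 \<omega>) (\<Inter>j\<in>c. A i j)) \<partial>M) =
          (\<integral>m. (\<Prod>i\<in>{1..I}. \<Prod>c\<in>\<pi> i. measure m (\<Inter>j\<in>c. A i j)) \<partial>\<mu>)" if \<pi>: "\<pi> \<in> ?\<Pi>" for \<pi>
      proof -
        let ?B = "\<lambda>ic. \<Inter>j\<in>snd ic. A (fst ic) j"
        have \<pi>i: "\<pi> i \<in> partitions (n i)" if "i \<in> {1..I}" for i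
          using \<pi> that by (auto simp: PiE_iff)
        \<comment> \<open>All blocks of all rows form one index set of pairs, so that the double
          product is a single moment of \<open>p0\<close>.\<close>
        have double: "(\<Prod>i\<in>{1..I}. \<Prod>c\<in>\<pi> i. measure m (\<Inter>j\<in>c. A i j)) =
            (\<Prod>ic\<in>Sigma {1..I} \<pi>. measure m (?B ic))" for m :: "'x measure"
          using partitionsD(1)[OF \<pi>i] by (simp add: prod.Sigma case_prod_beta)
        have B: "?B ic \<in> sets borel" if "ic \<in> Sigma {1..I} \<pi>" for ic
          using inter[OF _ \<pi>i] that by auto
        have fin: "finite (Sigma {1..I} \<pi>)"
          using partitionsD(1)[OF \<pi>i] by auto
        \<comment> \<open>Uniqueness of moments asks for at least one factor:
          \<open>1 \<le> I\<close> gives row 1, and \<open>1 \<le> n 1\<close> gives it a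
          block.\<close>
        have ne: "Sigma {1..I} \<pi> \<noteq> {}"
        proof -
          have "1 \<in> {1..I}"
            using assms(2) by simp
          moreover from this have "\<pi> 1 \<noteq> {}"
            using partitionsD(2)[OF \<pi>i] n by blast
          ultimately show ?thesis
            by blast
        qed
        have "integrable M (\<lambda>\<omega>. \<Prod>ic\<in>Sigma {1..I} \<pi>. measure (p0 \<omega>) (?B ic))"
        proof (rule M.integrable_const_bound[where B = 1])
          show "(\<lambda>\<omega>. \<Prod>ic\<in>Sigma {1..I} \<pi>. measure (p0 \<omega>) (?B ic)) \<in> borel_measurable M"
            using B by (intro measurable_compose[OF p0 borel_measurable_prod_measure])
          show "AE \<omega> in M. norm (\<Prod>ic\<in>Sigma {1..I} \<pi>. measure (p0 \<omega>) (?B ic)) \<le> 1"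
          proof (rule AE_I2)
            fix \<omega> assume "\<omega> \<in> space M"
            from prod_measure_bounds[OF measurable_space[OF p0 this], where B = ?B and K = "Sigma {1..I} \<pi>"]
            show "norm (\<Prod>ic\<in>Sigma {1..I} \<pi>. measure (p0 \<omega>) (?B ic)) \<le> 1"
              unfolding real_norm_def by linarith
          qed
        qed
        moreover have "(\<integral>\<omega>. (\<Prod>ic\<in>Sigma {1..I} \<pi>. measure (p0 \<omega>) (?B ic)) \<partial>M) =
            (\<integral>m. (\<Prod>ic\<in>Sigma {1..I} \<pi>. measure m (?B ic)) \<partial>?\<mu>0)"
          using B by (intro integral_distr[symmetric] p0 borel_measurable_prod_measure)
        moreover have "\<dots> = (\<integral>m. (\<Prod>ic\<in>Sigma {1..I} \<pi>. measure m (?B ic)) \<partial>\<mu>)"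
          by (rule is_SSrp_law_moments_unique[OF assms(8) \<mu> fin ne B])
        ultimately show ?thesis
          by (simp only: double)
      qed
      have "(\<integral>\<omega>. (\<Sum>\<pi>\<in>?\<Pi>. (\<Prod>i\<in>{1..I}. q (block_sizes (\<pi> i))) *
            (\<Prod>i\<in>{1..I}. \<Prod>c\<in>\<pi> i. measure (p0 \<omega>) (\<Inter>j\<in>c. A i j))) \<partial>M) =
          (\<Sum>\<pi>\<in>?\<Pi>. \<integral>\<omega>. (\<Prod>i\<in>{1..I}. q (block_sizes (\<pi> i))) *
            (\<Prod>i\<in>{1..I}. \<Prod>c\<in>\<pi> i. measure (p0 \<omega>) (\<Inter>j\<in>c. A i j)) \<partial>M)"
        by (rule Bochner_Integration.integral_sum) (rule integrable_mult_right, rule *[THEN conjunct1])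
      also have "\<dots> = (\<Sum>\<pi>\<in>?\<Pi>. (\<Prod>i\<in>{1..I}. q (block_sizes (\<pi> i))) *
          (\<integral>m. (\<Prod>i\<in>{1..I}. \<Prod>c\<in>\<pi> i. measure m (\<Inter>j\<in>c. A i j)) \<partial>\<mu>))"
        by (rule sum.cong[OF refl]) (simp only: integral_mult_right_zero * [THEN conjunct2])
      finally show ?thesis .
    qed
    finally show ?thesis .
  qed
  have \<xi>: "\<xi> i j \<in> M \<rightarrow>\<^sub>M borel" if "i \<in> {1..I}" "1 \<le> j" for i j
    using assms(12)[OF that] by (simp add: has_cond_law_def)
  show ?thesis
    unfolding HSSM_def
  proof (intro conjI ballI allI impI)
    show "\<exists>\<mu>. is_SSrp_law q0 H0 \<mu>"
      using assms(8) by (rule exI)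
  qed (rule \<xi> formula; assumption)+
qed

end
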